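(* Let $L/K$ be a finite extension, $L_S/K$ its maximal separable subextension, and $A=\mathrm{Aut}(L/K)$ with fixed field $L^A$. Then (1) There is a unique subextension $N'/K$ of $L/K$ such that $L/N'$ is normal with $[L:N']=d_K(L)$. (2) If $N''/K$ is a subextension of $L/K$ such that $L/N''$ is normal, then $N''\supset N'$. (3) $N'=(L^A)_S$, the maximal separable subextension of $L^A/K$; moreover $d_K(L)=r_K(L)\cdot[L:L_S]=l_K(L)$ and $d_K(L)\cdot s_K(L)=[L:K]$. Thus the multicluster size is the descending normal index. (4) $L/K$ is normal if and only if $d_K(L)=[L:K]$.
   Context: $K$ is any field (not necessarily perfect) with a fixed algebraic closure $\bar K$; all extensions are finite and contained in $\bar K$. The descending normal index $d_K(L)$ is the maximum of $[L:N]$ over intermediate fields $K\subset N\subset L$ such that $L/N$ is normal. The cluster size is $r_K(L)=|\mathrm{Aut}(L/K)|$; the multicluster size is $l_K(L)=[L:L_S]\cdot r_K(L)$; $s_K(L)$ is the number of distinct subfields of $\bar K$ isomorphic to $L$ over $K$. *)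

theory Defs
  imports "HOL-Algebra.Algebraic_Closure"
begin

text \<open>
  Fields are subfields (as sets) of one ambient ring \<open>R\<close>, which in the theorem is an algebraic
  closure of the base field. The degree of \<open>E\<close> over \<open>F\<close> is the library's \<open>(dim over F) E\<close>.
\<close>

definition fixed_field :: "'a set \<Rightarrow> ('a \<Rightarrow> 'a) set \<Rightarrow> 'a set"
  where "fixed_field L A = {x \<in> L. \<forall>\<sigma> \<in> A. \<sigma> x = x}"

context ring
begin

definition intermediate_field :: "'a set \<Rightarrow> 'a set \<Rightarrow> 'a set \<Rightarrow> bool"
  where "intermediate_field K N L \<longleftrightarrow> subfield N R \<and> K \<subseteq> N \<and> N \<subseteq> L"

text \<open>
  Splitting over \<open>L\<close> is splitting in the ring \<open>L\<close> itself. The library's \<open>splitted_on L\<close> would be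
  wrong here: it intersects with \<open>mset_set L\<close>, which ignores multiplicities and is empty if \<open>L\<close>
  is infinite.
\<close>

definition normal_extension :: "'a set \<Rightarrow> 'a set \<Rightarrow> bool"
  where "normal_extension N L \<longleftrightarrow>
           (\<forall>x \<in> L. (algebraic over N) x) \<and>
           (\<forall>p \<in> carrier (N[X]). pirreducible N p \<and> (\<exists>x \<in> L. eval p x = \<zero>) \<longrightarrow>
              ring.splitted (R \<lparr> carrier := L \<rparr>) p)"

text \<open>
  Separability of \<open>x\<close>: its minimal polynomial has no multiple root. The roots are taken in \<open>R\<close>,
  so this is the usual notion only if \<open>R\<close> is algebraically closed.
\<close>

definition separable_element :: "'a set \<Rightarrow> 'a \<Rightarrow> bool"
  where "separable_element K x \<longleftrightarrow>
           (algebraic over K) x \<and> (\<forall>a \<in> carrier R. alg_mult (Irr K x) a \<le> 1)"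

definition separable_extension :: "'a set \<Rightarrow> 'a set \<Rightarrow> bool"
  where "separable_extension K F \<longleftrightarrow> (\<forall>x \<in> F. separable_element K x)"

text \<open>The order on sets is inclusion.\<close>

definition max_separable_subextension :: "'a set \<Rightarrow> 'a set \<Rightarrow> 'a set"
  where "max_separable_subextension K L =
           (GREATEST F. intermediate_field K F L \<and> separable_extension K F)"

definition isos_over :: "'a set \<Rightarrow> 'a set \<Rightarrow> 'a set \<Rightarrow> ('a \<Rightarrow> 'a) set"
  where "isos_over K L F =
           {\<sigma> \<in> ring_iso (R \<lparr> carrier := L \<rparr>) (R \<lparr> carrier := F \<rparr>). \<forall>x \<in> K. \<sigma> x = x}"

text \<open>
  Automorphisms are made extensional (as in the library's \<open>Bij\<close>), so that maps agreeing on \<open>L\<close>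
  are equal and the cardinality counts automorphisms of \<open>L\<close>.
\<close>

definition Aut_over :: "'a set \<Rightarrow> 'a set \<Rightarrow> ('a \<Rightarrow> 'a) set"
  where "Aut_over K L = isos_over K L L \<inter> extensional L"

definition descending_normal_index :: "'a set \<Rightarrow> 'a set \<Rightarrow> nat"
  where "descending_normal_index K L =
           Max {(dim over N) L | N. intermediate_field K N L \<and> normal_extension N L}"

definition cluster_size :: "'a set \<Rightarrow> 'a set \<Rightarrow> nat"
  where "cluster_size K L = card (Aut_over K L)"

definition multicluster_size :: "'a set \<Rightarrow> 'a set \<Rightarrow> nat"
  where "multicluster_size K L =
           (dim over (max_separable_subextension K L)) L * cluster_size K L"

definition num_conjugate_fields :: "'a set \<Rightarrow> 'a set \<Rightarrow> nat"
  where "num_conjugate_fields K L =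
           card {F. intermediate_field K F (carrier R) \<and> isos_over K L F \<noteq> {}}"

end

end

theory Submission
  imports Defs "HOL-Computational_Algebra.Primes"
begin

text \<open>
  Let \<open>F\<close> be the fixed field of \<open>A = Aut(L/K)\<close> and \<open>C\<close> the set of its elements separable over \<open>K\<close>.
  Two embeddings of \<open>L\<close> over \<open>K\<close> that agree on \<open>C\<close> agree on \<open>F\<close>, because \<open>F/C\<close> is purely inseparable,
  and then have the same image, because \<open>x\<close> is a root of a polynomial over \<open>F\<close> with set of roots \<open>A x\<close>.
  Hence \<open>L/C\<close> is normal, and the conjugate fields of \<open>L\<close> correspond to the embeddings of the separable
  extension \<open>C/K\<close>, of which there are \<open>[C:K]\<close>. Each conjugate field is the image of \<open>|A|\<close> embeddings of
  \<open>L\<close>, and \<open>L\<close> has as many embeddings as its separable part, so \<open>[L:K] = [C:K] |A| [L:L\<^sub>S]\<close> and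
  \<open>[L:C] = |A| [L:L\<^sub>S]\<close>. If \<open>L/N\<close> is normal, then an element of \<open>C\<close> outside \<open>N\<close> would be moved to
  another root of its minimal polynomial by an element of \<open>A\<close>, so \<open>C\<close> lies in \<open>N\<close>.
\<close>

subsection \<open>Homomorphisms of subfields\<close>

text \<open>\<open>L/K\<close> may be inseparable and far from normal, so its automorphisms are too
  few to see the degree; what is counted instead are embeddings into the algebraic closure. Their
  number is at most multiplied by the degree of the minimal polynomial at each simple step, and by
  exactly that degree when the new generator is separable over \<open>K\<close>. The resulting set
  of embeddings of \<open>L\<close> is then counted twice, through images and through restrictions
  to the separable part, and comparing the two counts with the tower formula gives the index. Pure
  inseparability enters as an exponent \<open>q\<close> such that \<open>x^q\<close> is separable
  and raising to the power \<open>q\<close> is injective on the whole closure; the choice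
  \<open>q = 1\<close> covers separable elements and with them characteristic zero. In the contexts
  \<open>algebraically_closed\<close> the letter \<open>L\<close> is the ambient field, and the
  extension called \<open>L\<close> in the overview is called \<open>E\<close>.\<close>

context field
begin

lemma subfield_hom_ring_hom_ring:
  assumes "subfield M R" "\<phi> \<in> ring_hom (R\<lparr>carrier := M\<rparr>) R"
  shows "ring_hom_ring (R\<lparr>carrier := M\<rparr>) R \<phi>"
  using ring_hom_ringI2[OF subring_is_ring[OF subfieldE(1)[OF assms(1)]] ring_axioms assms(2)] .

lemma subfield_hom_inj:
  assumes "subfield M R" "\<phi> \<in> ring_hom (R\<lparr>carrier := M\<rparr>) R"
  shows "inj_on \<phi> M"
proof -
  interpret h: ring_hom_ring "R\<lparr>carrier := M\<rparr>" R \<phi>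
    using subfield_hom_ring_hom_ring[OF assms] .
  interpret F: field "R\<lparr>carrier := M\<rparr>" using subfield_iff(2)[OF assms(1)] .
  show ?thesis using h.img_is_subfield(1)[OF F.carrier_is_subfield] by simp
qed

lemma subfield_hom_image:
  assumes "subfield M R" "\<phi> \<in> ring_hom (R\<lparr>carrier := M\<rparr>) R"
  shows "subfield (\<phi> ` M) R"
proof -
  interpret h: ring_hom_ring "R\<lparr>carrier := M\<rparr>" R \<phi>
    using subfield_hom_ring_hom_ring[OF assms] .
  interpret F: field "R\<lparr>carrier := M\<rparr>" using subfield_iff(2)[OF assms(1)] .
  show ?thesis using h.img_is_subfield(2)[OF F.carrier_is_subfield] by simp
qed

text \<open>Polynomials are coefficient lists whose head is nonzero. A homomorphism out of a field
  is injective, so the head stays nonzero and the mapped list is again a polynomial without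
  normalization.\<close>

lemma map_poly_closed:
  assumes "subfield M R" "\<phi> \<in> ring_hom (R\<lparr>carrier := M\<rparr>) R" "p \<in> carrier (M[X])"
  shows "map \<phi> p \<in> carrier (poly_ring R)"
proof -
  interpret h: ring_hom_ring "R\<lparr>carrier := M\<rparr>" R \<phi>
    using subfield_hom_ring_hom_ring[OF assms(1,2)] .
  have p: "set p \<subseteq> M" "p \<noteq> [] \<Longrightarrow> hd p \<noteq> \<zero>"
    using assms(3) unfolding sym[OF univ_poly_carrier] polynomial_def by auto
  have "\<phi> (hd p) \<noteq> \<zero>" if "p \<noteq> []"
  proof -
    have "hd p \<in> M" "\<zero> \<in> M" using p that subringE(2)[OF subfieldE(1)[OF assms(1)]] by (auto simp: subset_iff)
    thus ?thesis using inj_onD[OF subfield_hom_inj[OF assms(1,2)], of "hd p" \<zero>] p(2)[OF that] h.hom_zero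
      by auto
  qed
  moreover have "set (map \<phi> p) \<subseteq> carrier R" using p h.hom_closed by auto
  ultimately show ?thesis
    unfolding sym[OF univ_poly_carrier] polynomial_def by (auto simp: hd_map)
qed

lemma map_poly_is_hom:
  assumes "subfield M R" "\<phi> \<in> ring_hom (R\<lparr>carrier := M\<rparr>) R"
  shows "map \<phi> \<in> ring_hom (M[X]) (poly_ring R)"
proof -
  interpret h: ring_hom_ring "R\<lparr>carrier := M\<rparr>" R \<phi>
    using subfield_hom_ring_hom_ring[OF assms(1,2)] .
  note sub = subfieldE(1)[OF assms(1)]
  interpret UP: ring "M[X]" using univ_poly_is_ring[OF sub] .
  have s: "set p \<subseteq> M" if "p \<in> carrier (M[X])" for p
    using that polynomial_incl unfolding sym[OF univ_poly_carrier] by blast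
  have n: "normalize (map \<phi> p) = map \<phi> p" if "p \<in> carrier (M[X])" for p
    using map_poly_closed[OF assms that] normalize_polynomial unfolding sym[OF univ_poly_carrier] by blast
  show ?thesis
  proof (rule ring_hom_memI)
    fix p q assume p: "p \<in> carrier (M[X])" and q: "q \<in> carrier (M[X])"
    show "map \<phi> p \<in> carrier (poly_ring R)" using map_poly_closed[OF assms p] .
    show "map \<phi> (p \<otimes>\<^bsub>M[X]\<^esub> q) = map \<phi> p \<otimes>\<^bsub>poly_ring R\<^esub> map \<phi> q"
      using h.poly_mult_hom'[of p q] s[OF p] s[OF q] n[OF UP.m_closed[OF p q]]
      unfolding univ_poly_mult poly_mult_consistent[OF sub] by simp
    show "map \<phi> (p \<oplus>\<^bsub>M[X]\<^esub> q) = map \<phi> p \<oplus>\<^bsub>poly_ring R\<^esub> map \<phi> q"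
      using h.poly_add_hom'[of p q] s[OF p] s[OF q] n[OF UP.a_closed[OF p q]]
      unfolding univ_poly_add poly_add_consistent[OF sub] by simp
  next
    show "map \<phi> \<one>\<^bsub>M[X]\<^esub> = \<one>\<^bsub>poly_ring R\<^esub>"
      using h.hom_one unfolding univ_poly_one by simp
  qed
qed

lemma eval_map_hom:
  assumes "subfield M R" "\<phi> \<in> ring_hom (R\<lparr>carrier := M\<rparr>) R" "a \<in> carrier R"
  shows "(\<lambda>p. eval (map \<phi> p) a) \<in> ring_hom (M[X]) R"
  using ring_hom_trans[OF map_poly_is_hom[OF assms(1,2)] eval_is_hom[OF carrier_is_subring assms(3)]]
  by (simp add: comp_def)

lemma hom_eval:
  assumes "subfield M R" "\<phi> \<in> ring_hom (R\<lparr>carrier := M\<rparr>) R" "p \<in> carrier (M[X])" "a \<in> M"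
  shows "\<phi> (eval p a) = eval (map \<phi> p) (\<phi> a)"
proof -
  interpret h: ring_hom_ring "R\<lparr>carrier := M\<rparr>" R \<phi>
    using subfield_hom_ring_hom_ring[OF assms(1,2)] .
  have s: "set p \<subseteq> M"
    using assms(3) polynomial_incl unfolding sym[OF univ_poly_carrier] by blast
  show ?thesis using h.eval_hom'[of a p] s assms(4) eval_consistent[OF subfieldE(1)[OF assms(1)]] by simp
qed

text \<open>\<open>M(x)\<close> is the image of evaluation at \<open>x\<close> on
  \<open>M[X]\<close>, whose kernel is generated by \<open>Irr M x\<close>. Applying
  \<open>\<phi>\<close> to the coefficients and evaluating at \<open>a\<close> kills that generator,
  so this second evaluation factors through \<open>M(x)\<close>.\<close>

lemma extend_hom_simple:
  assumes M: "subfield M R" and \<phi>: "\<phi> \<in> ring_hom (R\<lparr>carrier := M\<rparr>) R"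
    and x: "x \<in> carrier R" "(algebraic over M) x"
    and a: "a \<in> carrier R" "eval (map \<phi> (Irr M x)) a = \<zero>"
  obtains \<psi> where "\<psi> \<in> ring_hom (R\<lparr>carrier := simple_extension M x\<rparr>) R"
    "\<And>m. m \<in> M \<Longrightarrow> \<psi> m = \<phi> m" "\<psi> x = a"
proof -
  note sub = subfieldE(1)[OF M]
  interpret UP: domain "M[X]" using univ_poly_is_domain[OF sub] .
  interpret s: ring_hom_ring "R\<lparr>carrier := M\<rparr>" R \<phi>
    using subfield_hom_ring_hom_ring[OF M \<phi>] .
  note h1 = eval_is_hom[OF sub x(1)]
  note h2 = eval_map_hom[OF M \<phi> a(1)]
  interpret h1: ring_hom_ring "M[X]" R "\<lambda>p. eval p x"
    using ring_hom_ringI2[OF UP.ring_axioms ring_axioms h1] .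
  interpret h2: ring_hom_ring "M[X]" R "\<lambda>p. eval (map \<phi> p) a"
    using ring_hom_ringI2[OF UP.ring_axioms ring_axioms h2] .
  have ker: "eval (map \<phi> p) a = \<zero>" if p: "p \<in> carrier (M[X])" "eval p x = \<zero>" for p
  proof -
    note I = IrrE(1)[OF M x]
    have "Irr M x divides\<^bsub>M[X]\<^esub> p"
      using Irr_minimal[OF M x p] pdivides_iff_shell[OF M I p(1)] by simp
    then obtain q where "q \<in> carrier (M[X])" "p = Irr M x \<otimes>\<^bsub>M[X]\<^esub> q" by (auto elim: dividesE)
    thus ?thesis using h2.hom_mult[OF I] a(2) h2.hom_closed by simp
  qed
  have wd: "eval (map \<phi> p) a = eval (map \<phi> q) a"
    if p: "p \<in> carrier (M[X])" and q: "q \<in> carrier (M[X])" and e: "eval p x = eval q x" for p q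
  proof -
    have "eval (p \<ominus>\<^bsub>M[X]\<^esub> q) x = \<zero>"
      using h1.hom_add[OF p UP.a_inv_closed[OF q]] h1.hom_a_inv[OF q] e h1.hom_closed[OF q]
      by (simp add: a_minus_def r_neg)
    hence "eval (map \<phi> (p \<ominus>\<^bsub>M[X]\<^esub> q)) a = \<zero>" using ker p q by simp
    hence "eval (map \<phi> p) a \<ominus> eval (map \<phi> q) a = \<zero>"
      using h2.hom_add[OF p UP.a_inv_closed[OF q]] h2.hom_a_inv[OF q] by (simp add: a_minus_def)
    thus ?thesis using h2.hom_closed[OF p] h2.hom_closed[OF q] by simp
  qed
  \<comment> \<open>An arbitrary polynomial representing \<open>y\<close> is chosen;
    \<open>wd\<close> makes the value independent of the choice.\<close>
  define \<psi> where "\<psi> y = eval (map \<phi> (SOME p. p \<in> carrier (M[X]) \<and> eval p x = y)) a" for y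
  have \<psi>: "\<psi> (eval p x) = eval (map \<phi> p) a" if p: "p \<in> carrier (M[X])" for p
  proof -
    let ?q = "SOME q. q \<in> carrier (M[X]) \<and> eval q x = eval p x"
    have "?q \<in> carrier (M[X]) \<and> eval ?q x = eval p x" by (rule someI[of _ p]) (use p in simp)
    thus ?thesis unfolding \<psi>_def using wd p by blast
  qed
  have img: "simple_extension M x = (\<lambda>p. eval p x) ` carrier (M[X])"
    using simple_extension_as_eval_img[OF subfieldE(3)[OF M] x(1)] .
  have "\<psi> \<in> ring_hom (R\<lparr>carrier := simple_extension M x\<rparr>) R"
  proof (rule ring_hom_memI)
    fix u assume "u \<in> carrier (R\<lparr>carrier := simple_extension M x\<rparr>)"
    then obtain p where p: "p \<in> carrier (M[X])" "u = eval p x" using img by auto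
    show "\<psi> u \<in> carrier R" using \<psi>[OF p(1)] p(2) h2.hom_closed[OF p(1)] by simp
    fix v assume "v \<in> carrier (R\<lparr>carrier := simple_extension M x\<rparr>)"
    then obtain q where q: "q \<in> carrier (M[X])" "v = eval q x" using img by auto
    show "\<psi> (u \<otimes>\<^bsub>R\<lparr>carrier := simple_extension M x\<rparr>\<^esub> v) = \<psi> u \<otimes> \<psi> v"
      using \<psi>[OF p(1)] \<psi>[OF q(1)] \<psi>[OF UP.m_closed[OF p(1) q(1)]] p q h1.hom_mult[OF p(1) q(1)]
        h2.hom_mult[OF p(1) q(1)] by simp
    show "\<psi> (u \<oplus>\<^bsub>R\<lparr>carrier := simple_extension M x\<rparr>\<^esub> v) = \<psi> u \<oplus> \<psi> v"
      using \<psi>[OF p(1)] \<psi>[OF q(1)] \<psi>[OF UP.a_closed[OF p(1) q(1)]] p q h1.hom_add[OF p(1) q(1)]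
        h2.hom_add[OF p(1) q(1)] by simp
  next
    show "\<psi> \<one>\<^bsub>R\<lparr>carrier := simple_extension M x\<rparr>\<^esub> = \<one>"
      using \<psi>[OF UP.one_closed] h1.hom_one h2.hom_one by simp
  qed
  moreover have "\<psi> m = \<phi> m" if m: "m \<in> M" for m
  \<comment> \<open>The constant zero is represented by the empty list, since
    \<open>[\<zero>]\<close> has head zero and is not a polynomial.\<close>
  proof (cases "m = \<zero>")
    case True
    thus ?thesis using \<psi>[OF UP.zero_closed] h1.hom_zero h2.hom_zero
      s.hom_zero by simp
  next
    case False
    hence "[m] \<in> carrier (M[X])" using m unfolding sym[OF univ_poly_carrier] polynomial_def by simp
    from \<psi>[OF this] show ?thesis using m subfieldE(3)[OF M] ring_hom_memE(1)[OF \<phi>, of m] a(1) x(1) by (simp add: subset_iff)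
  qed
  moreover have "\<psi> x = a"
  proof -
    have "X \<in> carrier (M[X])" using var_closed(1)[OF sub] .
    moreover have "map \<phi> X = X"
      using s.hom_zero ring_hom_memE(4)[OF \<phi>]
      unfolding var_def by simp
    ultimately show ?thesis using \<psi>[of X] eval_var x(1) a(1) by simp
  qed
  ultimately show thesis using that by blast
qed

lemma hom_simple_extension_eqI:
  assumes M: "subfield M R" and x: "x \<in> carrier R" "(algebraic over M) x"
    and \<phi>: "\<phi> \<in> ring_hom (R\<lparr>carrier := simple_extension M x\<rparr>) R"
    and \<psi>: "\<psi> \<in> ring_hom (R\<lparr>carrier := simple_extension M x\<rparr>) R"
    and eq: "\<And>m. m \<in> M \<Longrightarrow> \<phi> m = \<psi> m" "\<phi> x = \<psi> x"
    and y: "y \<in> simple_extension M x"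
  shows "\<phi> y = \<psi> y"
proof -
  let ?E = "simple_extension M x"
  note E = simple_extension_is_subring[OF subfieldE(1)[OF M] x(1)]
  have xE: "x \<in> ?E" and ME: "M \<subseteq> ?E"
    using simple_extension_mem[OF subfieldE(1)[OF M] x(1)] simple_extension_incl[OF subfieldE(3)[OF M] x(1)] by auto
  show ?thesis using y
  proof (induction rule: simple_extension.induct)
    case zero
    show ?case using eq(1) subringE(2)[OF subfieldE(1)[OF M]] by blast
  next
    case (lin k1 k2)
    have "k1 \<otimes> x \<in> ?E" using subringE(6)[OF E] lin(1) xE by blast
    moreover have "k2 \<in> ?E" using ME lin(2) by blast
    ultimately show ?case
      using ring_hom_memE(2,3)[OF \<phi>] ring_hom_memE(2,3)[OF \<psi>] lin xE eq by simp
  qed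
qed

end

subsection \<open>Counting embeddings\<close>

text \<open>The codomain is the whole ambient ring, so that images may vary and one set contains the
  automorphisms and the isomorphisms onto all conjugate fields. Extensionality serves the same
  purpose as in \<open>Aut_over\<close>: the cardinality counts maps on \<open>M\<close>.\<close>

definition (in ring) embeddings :: "'a set \<Rightarrow> 'a set \<Rightarrow> ('a \<Rightarrow> 'a) set"
  where "embeddings K M =
           {\<phi> \<in> ring_hom (R\<lparr>carrier := M\<rparr>) R. \<forall>k\<in>K. \<phi> k = k} \<inter> extensional M"

context field
begin

section \<open>Distinct roots and multiplicities\<close>

lemma set_mset_roots:
  assumes "p \<in> carrier (poly_ring R)"
  shows "set_mset (roots p) = {a. is_root p a}"
  using roots_mem_iff_is_root[OF assms] by auto

lemma card_roots_le:
  assumes "p \<in> carrier (poly_ring R)"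
  shows "card {a. is_root p a} \<le> degree p"
proof -
  have "card (set_mset (roots p)) \<le> size (roots p)"
    unfolding size_multiset_overloaded_eq card_eq_sum by (rule sum_mono) (simp add: Suc_leI)
  thus ?thesis using size_roots_le_degree[OF assms] set_mset_roots[OF assms] by simp
qed

lemma restrict_subfield_hom:
  assumes "subring M R" "\<phi> \<in> ring_hom (R\<lparr>carrier := M\<rparr>) R" "subring F R" "F \<subseteq> M"
  shows "restrict \<phi> F \<in> ring_hom (R\<lparr>carrier := F\<rparr>) R"
  using assms(2,4) subringE[OF assms(3)] unfolding ring_hom_def by (auto simp: subset_iff)

end

lemma (in ring) univ_poly_carrier_mono:
  assumes "K \<subseteq> M" "p \<in> carrier (K[X])"
  shows "p \<in> carrier (M[X])"
  using assms unfolding sym[OF univ_poly_carrier] polynomial_def by auto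

context algebraically_closed
begin

text \<open>Over an algebraically closed field the multiset of roots has size equal to the degree,
  so its support has that size exactly when no element is repeated. This turns the definition of
  separability into a statement on numbers of roots.\<close>

lemma card_roots_eq_iff:
  assumes p: "p \<in> carrier (poly_ring L)"
  shows "card {a. is_root p a} = degree p \<longleftrightarrow> (\<forall>a \<in> carrier L. alg_mult p a \<le> 1)"
proof -
  have sz: "size (roots p) = degree p" using roots_over_carrier[OF p] unfolding splitted_def .
  have e: "size (roots p) = (\<Sum>a\<in>set_mset (roots p). count (roots p) a)"
    by (simp add: size_multiset_overloaded_eq)
  have c: "card {a. is_root p a} = (\<Sum>a\<in>set_mset (roots p). 1)" using set_mset_roots[OF p] by simp
  have am: "alg_mult p = count (roots p)" using alg_mult_eq_count_roots[OF p] .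
  have rc: "a \<in> carrier L" if "a \<in># roots p" for a
    using that roots_mem_iff_is_root[OF p] unfolding is_root_def by auto
  show ?thesis
  proof
    assume eq: "card {a. is_root p a} = degree p"
    show "\<forall>a \<in> carrier L. alg_mult p a \<le> 1"
    proof (rule ballI, rule ccontr)
      fix a assume "\<not> alg_mult p a \<le> 1"
      hence a: "count (roots p) a > 1" using am by simp
      hence "a \<in># roots p" using count_greater_zero_iff by fastforce
      hence "(\<Sum>a\<in>set_mset (roots p). 1) < (\<Sum>a\<in>set_mset (roots p). count (roots p) a)"
        by (intro sum_strict_mono_ex1) (use a in \<open>auto simp: Suc_leI\<close>)
      thus False using eq sz e c by simp
    qed
  next
    assume le: "\<forall>a \<in> carrier L. alg_mult p a \<le> 1"
    have "(\<Sum>a\<in>set_mset (roots p). count (roots p) a) = (\<Sum>a\<in>set_mset (roots p). 1)"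
    proof (rule sum.cong[OF refl])
      fix a assume a: "a \<in># roots p"
      hence "count (roots p) a > 0" by simp
      moreover have "count (roots p) a \<le> 1" using bspec[OF le rc[OF a]] am by simp
      ultimately show "count (roots p) a = 1" by linarith
    qed
    thus "card {a. is_root p a} = degree p" using sz e c by simp
  qed
qed

lemma alg_mult_mono:
  assumes "p \<in> carrier (poly_ring L)" "q \<in> carrier (poly_ring L)" "q \<noteq> []" "p pdivides q"
  shows "alg_mult p a \<le> alg_mult q a"
  unfolding alg_mult_eq_count_roots[OF assms(1)] alg_mult_eq_count_roots[OF assms(2)]
  using mset_subset_eq_count[OF pdivides_imp_roots_incl[OF assms]] .

lemma exists_root_of_degree_pos:
  assumes p: "p \<in> carrier (poly_ring L)" and "degree p \<ge> 1"
  obtains a where "a \<in> carrier L" "is_root p a"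
proof -
  have "size (roots p) \<ge> 1" using roots_over_carrier[OF p] assms(2) unfolding splitted_def by simp
  hence "roots p \<noteq> {#}" by auto
  then obtain a where "a \<in># roots p" by blast
  thus thesis using that roots_mem_iff_is_root[OF p] unfolding is_root_def by blast
qed

lemma Irr_in_poly_ring:
  assumes "subfield M L" "x \<in> carrier L" "(algebraic over M) x"
  shows "Irr M x \<in> carrier (poly_ring L)" "Irr M x \<noteq> []" "degree (Irr M x) \<ge> 1" "is_root (Irr M x) x"
proof -
  show c: "Irr M x \<in> carrier (poly_ring L)"
    using carrier_polynomial_shell[OF subfieldE(1)[OF assms(1)] IrrE(1)[OF assms]] .
  show d: "degree (Irr M x) \<ge> 1" using pirreducible_degree[OF assms(1) IrrE(1,2)[OF assms]] .
  thus n: "Irr M x \<noteq> []" by auto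
  show "is_root (Irr M x) x" using n IrrE(4)[OF assms] assms(2) unfolding is_root_def by simp
qed

section \<open>Embeddings of simple and of finitely generated extensions\<close>

lemma embeddingsD:
  assumes "\<phi> \<in> embeddings K M"
  shows "\<phi> \<in> ring_hom (L\<lparr>carrier := M\<rparr>) L" "\<And>k. k \<in> K \<Longrightarrow> \<phi> k = k" "\<phi> \<in> extensional M"
  using assms unfolding embeddings_def by auto

lemma restrict_embedding:
  assumes "subfield M L" "\<phi> \<in> embeddings K M" "subfield F L" "K \<subseteq> F" "F \<subseteq> M"
  shows "restrict \<phi> F \<in> embeddings K F"
  using restrict_subfield_hom[OF subfieldE(1)[OF assms(1)] embeddingsD(1)[OF assms(2)]
        subfieldE(1)[OF assms(3)] assms(5)] embeddingsD(2)[OF assms(2)] assms(4)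
  unfolding embeddings_def by auto

lemma restrict_in_embeddings:
  assumes M: "subfield M L" and "\<phi> \<in> ring_hom (L\<lparr>carrier := M\<rparr>) L" "\<And>k. k \<in> K \<Longrightarrow> \<phi> k = k" "K \<subseteq> M"
  shows "restrict \<phi> M \<in> embeddings K M"
  using restrict_subfield_hom[OF subfieldE(1)[OF M] assms(2) subfieldE(1)[OF M]] assms(3,4)
  unfolding embeddings_def by auto

lemma embeddings_self:
  assumes "subfield K L"
  shows "embeddings K K = {restrict id K}"
proof
  show "embeddings K K \<subseteq> {restrict id K}"
    unfolding embeddings_def by (auto simp: extensional_def fun_eq_iff)
  have "id \<in> ring_hom (L\<lparr>carrier := K\<rparr>) L"
    using subfieldE(3)[OF assms] by (auto intro!: ring_hom_memI)
  thus "{restrict id K} \<subseteq> embeddings K K" using restrict_in_embeddings[OF assms, of id K] by auto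
qed

text \<open>An embedding of \<open>M(x)\<close> is determined by its restriction
  \<open>\<phi>\<close> to \<open>M\<close> and by the image of \<open>x\<close>, which can be any
  root of the minimal polynomial transported by \<open>\<phi>\<close>. The dependent sum is the form
  in which the count passes through a tower.\<close>

lemma embeddings_simple_extension_bij:
  assumes M: "subfield M L" and KM: "K \<subseteq> M" and x: "x \<in> carrier L" "(algebraic over M) x"
  shows "bij_betw (\<lambda>\<psi>. (restrict \<psi> M, \<psi> x)) (embeddings K (simple_extension M x))
           (SIGMA \<phi>:embeddings K M. {a. is_root (map \<phi> (Irr M x)) a})"
proof -
  let ?E = "simple_extension M x"
  have E: "subfield ?E L" using simple_extension_is_subfield[OF M x(1)] x(2) by simp
  have xE: "x \<in> ?E" and ME: "M \<subseteq> ?E"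
    using simple_extension_mem[OF subfieldE(1)[OF M] x(1)] simple_extension_incl[OF subfieldE(3)[OF M] x(1)] by auto
  note I = Irr_in_poly_ring[OF M x] IrrE[OF M x]
  have setI: "set (Irr M x) \<subseteq> M"
    using I(5) polynomial_incl unfolding sym[OF univ_poly_carrier] by blast
  have inj: "inj_on (\<lambda>\<psi>. (restrict \<psi> M, \<psi> x)) (embeddings K ?E)"
  proof (rule inj_onI)
    fix \<phi> \<psi> assume h: "\<phi> \<in> embeddings K ?E" "\<psi> \<in> embeddings K ?E"
      and eq: "(restrict \<phi> M, \<phi> x) = (restrict \<psi> M, \<psi> x)"
    have "\<phi> m = \<psi> m" if "m \<in> M" for m
      using fun_cong[OF arg_cong[OF eq, of fst], of m] that by simp
    moreover have "\<phi> x = \<psi> x" using arg_cong[OF eq, of snd] by simp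
    ultimately have eqE: "\<phi> y = \<psi> y" if "y \<in> ?E" for y
      by (rule hom_simple_extension_eqI[OF M x embeddingsD(1)[OF h(1)] embeddingsD(1)[OF h(2)] _ _ that])
    show "\<phi> = \<psi>" by (rule extensionalityI[OF embeddingsD(3)[OF h(1)] embeddingsD(3)[OF h(2)] eqE])
  qed
  moreover have "(\<lambda>\<psi>. (restrict \<psi> M, \<psi> x)) ` embeddings K ?E =
      (SIGMA \<phi>:embeddings K M. {a. is_root (map \<phi> (Irr M x)) a})"
  proof (intro equalityI subsetI)
    fix z assume "z \<in> (\<lambda>\<psi>. (restrict \<psi> M, \<psi> x)) ` embeddings K ?E"
    then obtain \<psi> where \<psi>: "\<psi> \<in> embeddings K ?E" "z = (restrict \<psi> M, \<psi> x)" by (elim imageE)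
    have m: "map (restrict \<psi> M) (Irr M x) = map \<psi> (Irr M x)"
      by (rule map_cong[OF refl]) (use setI in auto)
    have IE: "Irr M x \<in> carrier (?E[X])" using univ_poly_carrier_mono[OF ME I(5)] .
    have "eval (map \<psi> (Irr M x)) (\<psi> x) = \<zero>"
      using hom_eval[OF E embeddingsD(1)[OF \<psi>(1)] IE xE] I(8)
        ring_hom_zero[OF embeddingsD(1)[OF \<psi>(1)] subring_is_ring[OF subfieldE(1)[OF E]] ring_axioms] by simp
    hence "is_root (map \<psi> (Irr M x)) (\<psi> x)"
      using I(2) ring_hom_memE(1)[OF embeddingsD(1)[OF \<psi>(1)], of x] xE unfolding is_root_def by simp
    thus "z \<in> (SIGMA \<phi>:embeddings K M. {a. is_root (map \<phi> (Irr M x)) a})"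
      unfolding \<psi>(2) by (intro SigmaI restrict_embedding[OF E \<psi>(1) M KM ME]) (unfold m, simp)
  next
    fix z assume "z \<in> (SIGMA \<phi>:embeddings K M. {a. is_root (map \<phi> (Irr M x)) a})"
    then obtain \<phi> a where z: "z = (\<phi>, a)" "\<phi> \<in> embeddings K M" "is_root (map \<phi> (Irr M x)) a" by blast
    have a: "a \<in> carrier L" "eval (map \<phi> (Irr M x)) a = \<zero>" using z(3) unfolding is_root_def by simp_all
    obtain \<psi> where \<psi>: "\<psi> \<in> ring_hom (L\<lparr>carrier := ?E\<rparr>) L" "\<And>m. m \<in> M \<Longrightarrow> \<psi> m = \<phi> m" "\<psi> x = a"
      by (rule extend_hom_simple[OF M embeddingsD(1)[OF z(2)] x a]) blast
    have "restrict \<psi> ?E \<in> embeddings K ?E"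
      using restrict_in_embeddings[OF E \<psi>(1)] \<psi>(2) embeddingsD(2)[OF z(2)] KM ME by (simp add: subset_iff)
    moreover have "restrict (restrict \<psi> ?E) M = \<phi>"
    proof (rule extensionalityI[OF restrict_extensional embeddingsD(3)[OF z(2)]])
      fix m assume "m \<in> M"
      thus "restrict (restrict \<psi> ?E) M m = \<phi> m" using \<psi>(2) ME by auto
    qed
    ultimately show "z \<in> (\<lambda>\<psi>. (restrict \<psi> M, \<psi> x)) ` embeddings K ?E"
      using z(1) \<psi>(3) xE by (auto intro!: image_eqI[of _ _ "restrict \<psi> ?E"])
  qed
  ultimately show ?thesis unfolding bij_betw_def by blast
qed

lemma map_Irr_root_set:
  assumes M: "subfield M L" and x: "x \<in> carrier L" "(algebraic over M) x"
    and \<phi>: "\<phi> \<in> ring_hom (L\<lparr>carrier := M\<rparr>) L"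
  shows "finite {a. is_root (map \<phi> (Irr M x)) a}" "{a. is_root (map \<phi> (Irr M x)) a} \<noteq> {}"
    "card {a. is_root (map \<phi> (Irr M x)) a} \<le> degree (Irr M x)"
proof -
  have p: "map \<phi> (Irr M x) \<in> carrier (poly_ring L)" using map_poly_closed[OF M \<phi> IrrE(1)[OF M x]] .
  show "finite {a. is_root (map \<phi> (Irr M x)) a}" using finite_number_of_roots[OF p] .
  show "{a. is_root (map \<phi> (Irr M x)) a} \<noteq> {}"
  proof -
    have "degree (map \<phi> (Irr M x)) \<ge> 1" using Irr_in_poly_ring(3)[OF M x] by simp
    then obtain a where "is_root (map \<phi> (Irr M x)) a" by (rule exists_root_of_degree_pos[OF p])
    thus ?thesis by blast
  qed
  show "card {a. is_root (map \<phi> (Irr M x)) a} \<le> degree (Irr M x)" using card_roots_le[OF p] by simp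
qed

text \<open>Since \<open>\<phi>\<close> fixes \<open>K\<close>, it leaves \<open>Irr K x\<close>
  unchanged. The image of \<open>Irr M x\<close> therefore divides \<open>Irr K x\<close>, which has
  only simple roots, and this happens for every \<open>\<phi>\<close> alike.\<close>

lemma card_map_Irr_roots_separable:
  assumes K: "subfield K L" and M: "subfield M L" and KM: "K \<subseteq> M"
    and x: "x \<in> carrier L" "separable_element K x" and \<phi>: "\<phi> \<in> embeddings K M"
  shows "card {a. is_root (map \<phi> (Irr M x)) a} = degree (Irr M x)"
proof -
  note \<phi>h = embeddingsD(1)[OF \<phi>]
  have aK: "(algebraic over K) x" using x(2) unfolding separable_element_def by simp
  have aM: "(algebraic over M) x" using algebraic_mono[OF KM] aK by simp
  note KX = univ_poly_carrier_mono[OF KM]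
  note IK = IrrE[OF K x(1) aK] and IM = IrrE[OF M x(1) aM]
  have mp: "map \<phi> (Irr M x) \<in> carrier (poly_ring L)" using map_poly_closed[OF M \<phi>h IM(1)] .
  have "Irr M x divides\<^bsub>M[X]\<^esub> Irr K x"
    using Irr_minimal[OF M x(1) aM KX[OF IK(1)] IK(4)] pdivides_iff_shell[OF M IM(1) KX[OF IK(1)]] by simp
  then obtain q where q: "q \<in> carrier (M[X])" "Irr K x = Irr M x \<otimes>\<^bsub>M[X]\<^esub> q" by (auto elim: dividesE)
  have "set (Irr K x) \<subseteq> K" using IK(1) polynomial_incl unfolding sym[OF univ_poly_carrier] by blast
  hence "map \<phi> (Irr K x) = Irr K x" using embeddingsD(2)[OF \<phi>] by (simp add: map_idI subset_iff)
  hence "Irr K x = map \<phi> (Irr M x) \<otimes>\<^bsub>poly_ring L\<^esub> map \<phi> q"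
    using ring_hom_memE(2)[OF map_poly_is_hom[OF M \<phi>h] IM(1) q(1)] q(2) by simp
  hence "map \<phi> (Irr M x) pdivides Irr K x"
    using map_poly_closed[OF M \<phi>h q(1)] unfolding pdivides_def by (auto intro: dividesI)
  hence "alg_mult (map \<phi> (Irr M x)) a \<le> 1" if "a \<in> carrier L" for a
    using alg_mult_mono[OF mp Irr_in_poly_ring(1,2)[OF K x(1) aK], of a] x(2) that
    unfolding separable_element_def by force
  thus ?thesis using card_roots_eq_iff[OF mp] by simp
qed

lemma embeddings_simple_extension:
  assumes K: "subfield K L" and M: "subfield M L" and KM: "K \<subseteq> M"
    and x: "x \<in> carrier L" "(algebraic over M) x" and fin: "finite (embeddings K M)"
  shows "finite (embeddings K (simple_extension M x))"
    "card (embeddings K (simple_extension M x)) \<le> card (embeddings K M) * degree (Irr M x)"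
    "separable_element K x \<Longrightarrow>
       card (embeddings K (simple_extension M x)) = card (embeddings K M) * degree (Irr M x)"
proof -
  let ?S = "SIGMA \<phi>:embeddings K M. {a. is_root (map \<phi> (Irr M x)) a}"
  note bij = embeddings_simple_extension_bij[OF M KM x]
  note r = map_Irr_root_set[OF M x embeddingsD(1)]
  have c: "card (embeddings K (simple_extension M x)) = (\<Sum>\<phi>\<in>embeddings K M. card {a. is_root (map \<phi> (Irr M x)) a})"
    unfolding bij_betw_same_card[OF bij] by (rule card_SigmaI[OF fin]) (use r(1) in blast)
  show "finite (embeddings K (simple_extension M x))"
    using bij_betw_finite[OF bij] fin r(1) by auto
  show "card (embeddings K (simple_extension M x)) \<le> card (embeddings K M) * degree (Irr M x)"
    unfolding c using sum_bounded_above[of "embeddings K M", OF r(3)] by simp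
  show "card (embeddings K (simple_extension M x)) = card (embeddings K M) * degree (Irr M x)"
    if "separable_element K x"
    unfolding c using card_map_Irr_roots_separable[OF K M KM x(1) that] by simp
qed

text \<open>Each adjoined generator multiplies the degree by the degree of its minimal polynomial,
  and the number of embeddings by at most that much. The equality asks for separability over the
  bottom field \<open>K\<close>, which carries over to every stage of the list.\<close>

lemma embeddings_finite_extension:
  assumes K: "subfield K L" and M: "subfield M L" and KM: "K \<subseteq> M"
    and xs: "set xs \<subseteq> carrier L" "\<And>x. x \<in> set xs \<Longrightarrow> (algebraic over M) x" and fin: "finite (embeddings K M)"
  shows "finite (embeddings K (finite_extension M xs))"
    "card (embeddings K (finite_extension M xs)) \<le> card (embeddings K M) * (dim over M) (finite_extension M xs)"
    "(\<And>x. x \<in> set xs \<Longrightarrow> separable_element K x) \<Longrightarrow>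
      card (embeddings K (finite_extension M xs)) = card (embeddings K M) * (dim over M) (finite_extension M xs)"
proof -
  let ?A = "finite (embeddings K (finite_extension M xs))"
  let ?B = "card (embeddings K (finite_extension M xs)) \<le> card (embeddings K M) * (dim over M) (finite_extension M xs)"
  let ?C = "card (embeddings K (finite_extension M xs)) = card (embeddings K M) * (dim over M) (finite_extension M xs)"
  \<comment> \<open>The three claims share one induction, because counting over the pairs at the
    next stage presupposes that the previous set of embeddings is finite.\<close>
  have R: "?A \<and> ?B \<and> ((\<forall>x\<in>set xs. separable_element K x) \<longrightarrow> ?C)"
  proof -
    have "set xs \<subseteq> carrier L" "\<forall>x\<in>set xs. (algebraic over M) x" using xs by auto
    thus ?thesis
    proof (induction xs)
      case Nil
      have "(dim over M) M = 1" using dimI[OF M dimension_one[OF M]] .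
      thus ?case using fin by simp
    next
      case (Cons x xs)
      let ?F = "finite_extension M xs"
      have F: "subfield ?F L" using finite_extension_is_subfield[OF M] Cons.prems by simp
      have MF: "M \<subseteq> ?F" using finite_extension_incl[OF subfieldE(3)[OF M]] Cons.prems by simp
      have KF: "K \<subseteq> ?F" using KM MF by blast
      have x: "x \<in> carrier L" "(algebraic over ?F) x"
        using Cons.prems algebraic_mono[OF MF] by simp_all
      have fd: "finite_dimension M ?F" using finite_extension_finite_dimension(1)[OF M] Cons.prems by simp
      have fd2: "finite_dimension ?F (simple_extension ?F x)"
        using finite_dimension_simple_extension[OF F x(1)] x(2) by simp
      have d: "(dim over M) (simple_extension ?F x) = (dim over M) ?F * degree (Irr ?F x)"
        using telescopic_base_dim(2)[OF M F fd fd2] simple_extension_dim[OF F x] by simp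
      have IH: "finite (embeddings K ?F)" "card (embeddings K ?F) \<le> card (embeddings K M) * (dim over M) ?F"
        "(\<forall>x\<in>set xs. separable_element K x) \<longrightarrow> card (embeddings K ?F) = card (embeddings K M) * (dim over M) ?F"
      proof -
        have "set xs \<subseteq> carrier L" "\<forall>y\<in>set xs. (algebraic over M) y"
          using Cons.prems by simp_all
        note R = Cons.IH[OF this]
        show "finite (embeddings K ?F)" "card (embeddings K ?F) \<le> card (embeddings K M) * (dim over M) ?F"
          "(\<forall>x\<in>set xs. separable_element K x) \<longrightarrow> card (embeddings K ?F) = card (embeddings K M) * (dim over M) ?F"
          using conjunct1[OF R] conjunct1[OF conjunct2[OF R]] conjunct2[OF conjunct2[OF R]] .
      qed
      note s = embeddings_simple_extension[OF K F KF x IH(1)]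
      have "card (embeddings K (simple_extension ?F x)) \<le> card (embeddings K M) * (dim over M) ?F * degree (Irr ?F x)"
        using s(2) IH(2) by (meson le_trans mult_le_mono1)
      hence B: "card (embeddings K (simple_extension ?F x)) \<le> card (embeddings K M) * (dim over M) (simple_extension ?F x)"
        unfolding d by (simp only: mult.assoc)
      have C: "card (embeddings K (simple_extension ?F x)) = card (embeddings K M) * (dim over M) (simple_extension ?F x)"
        if "\<forall>x\<in>set (x # xs). separable_element K x"
      proof -
        have s1: "separable_element K x" and s2: "\<forall>x\<in>set xs. separable_element K x" using that by simp_all
        show ?thesis unfolding d s(3)[OF s1] mp[OF IH(3) s2] by (rule mult.assoc)
      qed
      have e: "finite_extension M (x # xs) = simple_extension ?F x" by simp
      show ?case unfolding e by (intro conjI impI s(1) B C)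
    qed
  qed
  show ?A using R by (elim conjE)
  show ?B using R by (elim conjE)
  assume "\<And>x. x \<in> set xs \<Longrightarrow> separable_element K x"
  hence "\<forall>x\<in>set xs. separable_element K x" by (rule ballI)
  with R show ?C by (elim conjE) (erule mp)
qed

text \<open>The transported minimal polynomial of each new generator has a root because the ambient
  field is algebraically closed, and any such root gives a prolongation.\<close>

lemma extend_embedding:
  assumes K: "subfield K L" and M: "subfield M L" and KM: "K \<subseteq> M"
    and xs: "set xs \<subseteq> carrier L" "\<And>x. x \<in> set xs \<Longrightarrow> (algebraic over M) x"
    and \<phi>: "\<phi> \<in> embeddings K M"
  shows "\<exists>\<psi> \<in> embeddings K (finite_extension M xs). restrict \<psi> M = \<phi>"
proof -
  have "set xs \<subseteq> carrier L" "\<forall>x\<in>set xs. (algebraic over M) x" using xs by auto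
  thus ?thesis
  proof (induction xs)
    case Nil
    have "restrict \<phi> M = \<phi>" using embeddingsD(3)[OF \<phi>] by (rule extensional_restrict)
    thus ?case using \<phi> by (intro bexI[of _ \<phi>]) simp_all
  next
    case (Cons x xs)
    let ?F = "finite_extension M xs"
    have F: "subfield ?F L" using finite_extension_is_subfield[OF M] Cons.prems by simp
    have MF: "M \<subseteq> ?F" using finite_extension_incl[OF subfieldE(3)[OF M]] Cons.prems by simp
    have KF: "K \<subseteq> ?F" using KM MF by blast
    have x: "x \<in> carrier L" "(algebraic over ?F) x"
      using Cons.prems algebraic_mono[OF MF] by simp_all
    have "set xs \<subseteq> carrier L" "\<forall>y\<in>set xs. (algebraic over M) y"
      using Cons.prems by simp_all
    then obtain \<psi> where \<psi>: "\<psi> \<in> embeddings K ?F" "restrict \<psi> M = \<phi>"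
      using Cons.IH by blast
    obtain a where a: "is_root (map \<psi> (Irr ?F x)) a"
      using map_Irr_root_set(2)[OF F x embeddingsD(1)[OF \<psi>(1)]] by blast
    hence "(\<psi>, a) \<in> (\<lambda>\<psi>. (restrict \<psi> ?F, \<psi> x)) ` embeddings K (simple_extension ?F x)"
      using embeddings_simple_extension_bij[OF F KF x] \<psi>(1) unfolding bij_betw_def by simp
    then obtain \<theta> where \<theta>: "\<theta> \<in> embeddings K (simple_extension ?F x)" "restrict \<theta> ?F = \<psi>" by auto
    have "restrict \<theta> M = restrict (restrict \<theta> ?F) M" using MF by (simp add: restrict_restrict Int_absorb1)
    hence "restrict \<theta> M = \<phi>" unfolding \<theta>(2) \<psi>(2) .
    moreover have "finite_extension M (x # xs) = simple_extension ?F x" by simp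
    ultimately show ?case using \<theta>(1) by metis
  qed
qed

end

subsection \<open>Separable elements\<close>

context field
begin

section \<open>Degrees in towers of finite extensions\<close>

lemma subfield_is_subalgebra:
  assumes "subfield K R" "subfield M R" "K \<subseteq> M"
  shows "subalgebra K M R"
proof -
  have "subgroup M (add_monoid R)" using subring.axioms(1)[OF subfieldE(1)[OF assms(2)]] .
  thus ?thesis
    using subringE(6)[OF subfieldE(1)[OF assms(2)]] assms(3)
    unfolding subalgebra_def subalgebra_axioms_def by blast
qed

text \<open>A basis of \<open>E\<close> over \<open>K\<close> generates \<open>E\<close> as a field
  over every intermediate \<open>M\<close>. Taking the basis over \<open>K\<close> and not over
  \<open>M\<close> avoids a circle, since the finiteness of \<open>E\<close> over \<open>M\<close>
  is derived from this lemma.\<close>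

lemma finite_extension_generators:
  assumes K: "subfield K R" and M: "subfield M R" and E: "subfield E R" and KM: "K \<subseteq> M" and ME: "M \<subseteq> E"
    and fin: "finite_dimension K E"
  obtains xs where "set xs \<subseteq> E" "set xs \<subseteq> carrier R" "\<And>x. x \<in> set xs \<Longrightarrow> (algebraic over M) x"
    "E = finite_extension M xs"
proof -
  obtain n where "dimension n K E" using fin by (rule finite_dimensionE')
  then obtain Us where Us: "set Us \<subseteq> carrier R" "Span K Us = E"
    using exists_base[OF K] by blast
  have UE: "set Us \<subseteq> E" using Span_base_incl[OF K Us(1)] Us(2) by simp
  have alg: "(algebraic over M) x" if "x \<in> set Us" for x
    using algebraic_mono[OF KM finite_dimension_imp_algebraic[OF K subfieldE(1)[OF E] fin]] UE that by blast
  have F: "subfield (finite_extension M Us) R" using finite_extension_is_subfield[OF M Us(1) alg] .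
  have "finite_extension M Us \<subseteq> E" using finite_extension_subring_incl[OF subfieldE(1)[OF E] ME UE] .
  moreover have "Span K Us \<subseteq> finite_extension M Us"
    using finite_extension_incl[OF subfieldE(3)[OF M] Us(1)] KM
    by (intro subalgebra_Span_incl[OF K subfield_is_subalgebra[OF K F]]
          finite_extension_mem[OF subfieldE(1)[OF M] Us(1)]) blast
  ultimately show thesis using that[OF UE Us(1) alg] Us(2) by blast
qed

text \<open>The elements of a \<open>K\<close>-basis are finitely many algebraic generators over
  \<open>M\<close>, which bounds the upper degree. The last claim, that this degree is positive, is
  there so that it can be cancelled in the tower formula.\<close>

lemma finite_dimension_intermediate:
  assumes K: "subfield K R" and M: "subfield M R" and E: "subfield E R" and KM: "K \<subseteq> M" and ME: "M \<subseteq> E"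
    and fin: "finite_dimension K E"
  shows "finite_dimension K M" "finite_dimension M E" "(dim over K) E = (dim over K) M * (dim over M) E"
    "(dim over M) E \<ge> 1"
proof -
  show KM': "finite_dimension K M"
    using subalbegra_incl_imp_finite_dimension[OF K fin subfield_is_subalgebra[OF K M KM] ME] .
  obtain xs where xs: "set xs \<subseteq> carrier R" "\<And>x. x \<in> set xs \<Longrightarrow> (algebraic over M) x" "E = finite_extension M xs"
    by (rule finite_extension_generators[OF assms]) blast
  show ME': "finite_dimension M E"
    using finite_extension_finite_dimension(1)[OF M xs(1,2)] xs(3) by simp
  show "(dim over K) E = (dim over K) M * (dim over M) E"
    using telescopic_base_dim(2)[OF K M KM' ME'] .
  have "(dim over M) E \<noteq> 0"
  proof
    assume "(dim over M) E = 0"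
    hence "E = {\<zero>}" using dimension_zero[OF M] finite_dimensionE[OF M ME'] by simp
    thus False using subringE(3)[OF subfieldE(1)[OF E]] one_not_zero by simp
  qed
  thus "(dim over M) E \<ge> 1" by simp
qed

text \<open>Cancelling in the tower formula leaves degree one over \<open>M\<close>, so the single
  element \<open>\<one>\<close> spans \<open>E\<close> over \<open>M\<close>.\<close>

lemma subfield_eq_of_dim_eq:
  assumes K: "subfield K R" and M: "subfield M R" and E: "subfield E R" and KM: "K \<subseteq> M" and ME: "M \<subseteq> E"
    and fin: "finite_dimension K E" and eq: "(dim over K) E = (dim over K) M"
  shows "M = E"
proof -
  note d = finite_dimension_intermediate[OF assms(1-6)]
  have "(dim over K) M \<ge> 1"
    using finite_dimension_intermediate(4)[OF K K M _ KM d(1)] by simp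
  hence "(dim over M) E = 1" using d(3) eq by simp
  hence "dimension 1 M E" using finite_dimensionE[OF M d(2)] by simp
  moreover have "independent M [\<one>]"
    by (rule li_Cons) (use one_not_zero in auto)
  ultimately have "Span M [\<one>] = E"
    using independent_length_eq_dimension[OF M, of 1 E "[\<one>]"] subringE(3)[OF subfieldE(1)[OF E]] by simp
  moreover have "Span M [\<one>] \<subseteq> M"
    using subalgebra_Span_incl[OF M subfield_is_subalgebra[OF M M], of "[\<one>]"] subringE(3)[OF subfieldE(1)[OF M]] by simp
  ultimately show ?thesis using ME by blast
qed

end

context algebraically_closed
begin

section \<open>Embeddings of finite extensions and the field of separable elements\<close>

lemma embeddings_finite:
  assumes "subfield K L" "subfield M L" "K \<subseteq> M" "finite_dimension K M"
  shows "finite (embeddings K M)"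
proof -
  obtain xs where xs: "set xs \<subseteq> carrier L" "\<And>x. x \<in> set xs \<Longrightarrow> (algebraic over K) x" "M = finite_extension K xs"
    by (rule finite_extension_generators[OF assms(1,1,2) _ assms(3,4)]) blast+
  show ?thesis
    using embeddings_finite_extension(1)[OF assms(1,1) _ xs(1,2)] embeddings_self[OF assms(1)] xs(3) by simp
qed

lemma card_embeddings_le:
  assumes "subfield K L" "subfield M L" "subfield E L" "K \<subseteq> M" "M \<subseteq> E" "finite_dimension K E"
  shows "card (embeddings K E) \<le> card (embeddings K M) * (dim over M) E"
proof -
  obtain xs where xs: "set xs \<subseteq> carrier L" "\<And>x. x \<in> set xs \<Longrightarrow> (algebraic over M) x" "E = finite_extension M xs"
    by (rule finite_extension_generators[OF assms]) blast
  have "finite (embeddings K M)"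
    using embeddings_finite[OF assms(1,2,4) finite_dimension_intermediate(1)[OF assms]] .
  thus ?thesis
    using embeddings_finite_extension(2)[OF assms(1,2,4) xs(1,2)] xs(3) by simp
qed

lemma exists_extension_of_embedding:
  assumes "subfield K L" "subfield M L" "subfield E L" "K \<subseteq> M" "M \<subseteq> E" "finite_dimension K E"
    and \<phi>: "\<phi> \<in> embeddings K M"
  obtains \<psi> where "\<psi> \<in> embeddings K E" "restrict \<psi> M = \<phi>"
proof -
  obtain xs where xs: "set xs \<subseteq> carrier L" "\<And>x. x \<in> set xs \<Longrightarrow> (algebraic over M) x" "E = finite_extension M xs"
    by (rule finite_extension_generators[OF assms(1-6)]) blast
  show thesis using extend_embedding[OF assms(1,2,4) xs(1,2) \<phi>] xs(3) that by blast
qed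

lemma card_embeddings_separably_generated:
  assumes "subfield K L" "set xs \<subseteq> carrier L" "\<And>x. x \<in> set xs \<Longrightarrow> separable_element K x"
  shows "card (embeddings K (finite_extension K xs)) = (dim over K) (finite_extension K xs)"
proof -
  have alg: "\<And>x. x \<in> set xs \<Longrightarrow> (algebraic over K) x"
    using assms(3) unfolding separable_element_def by blast
  show ?thesis
    using embeddings_finite_extension(3)[OF assms(1,1) _ assms(2) alg _ assms(3)] embeddings_self[OF assms(1)] by simp
qed

text \<open>If \<open>z\<close> were not separable, then the embeddings of \<open>K(xs)\<close> over \<open>K\<close>, counted through \<open>K(z)\<close>,
  would be fewer than the degree.\<close>

lemma separable_finite_extension:
  assumes K: "subfield K L" and xs: "set xs \<subseteq> carrier L" "\<And>x. x \<in> set xs \<Longrightarrow> separable_element K x"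
    and z: "z \<in> finite_extension K xs"
  shows "separable_element K z"
proof -
  let ?E = "finite_extension K xs" and ?M = "simple_extension K z"
  have alg: "\<And>x. x \<in> set xs \<Longrightarrow> (algebraic over K) x"
    using xs(2) unfolding separable_element_def by blast
  have E: "subfield ?E L" using finite_extension_is_subfield[OF K xs(1) alg] .
  have KE: "K \<subseteq> ?E" using finite_extension_incl[OF subfieldE(3)[OF K] xs(1)] .
  have fin: "finite_dimension K ?E" using finite_extension_finite_dimension(1)[OF K xs(1) alg] .
  have zc: "z \<in> carrier L" using z subfieldE(3)[OF E] by blast
  have az: "(algebraic over K) z" using finite_dimension_imp_algebraic[OF K subfieldE(1)[OF E] fin z] .
  have M: "subfield ?M L" using simple_extension_is_subfield[OF K zc] az by simp
  have KM: "K \<subseteq> ?M" using simple_extension_incl[OF subfieldE(3)[OF K] zc] .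
  have ME: "?M \<subseteq> ?E" using simple_extension_subring_incl[OF subfieldE(1)[OF E] KE z] .
  note d = finite_dimension_intermediate[OF K M E KM ME fin]
  have "(dim over K) ?M * (dim over ?M) ?E = card (embeddings K ?E)"
    using d(3) card_embeddings_separably_generated[OF K xs] by simp
  also have "\<dots> \<le> card (embeddings K ?M) * (dim over ?M) ?E"
    using card_embeddings_le[OF K M E KM ME fin] .
  \<comment> \<open>The positive degree of the upper layer cancels, leaving the count for
    \<open>K(z)\<close> alone.\<close>
  finally have le: "degree (Irr K z) \<le> card (embeddings K ?M)"
    using d(4) simple_extension_dim[OF K zc az] by simp
  have I: "Irr K z \<in> carrier (poly_ring L)" using Irr_in_poly_ring(1)[OF K zc az] .
  have "set (Irr K z) \<subseteq> K" using IrrE(1)[OF K zc az] polynomial_incl unfolding sym[OF univ_poly_carrier] by blast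
  hence m: "map (restrict id K) (Irr K z) = Irr K z" by (intro map_idI) auto
  \<comment> \<open>The identity is the only embedding of \<open>K\<close> over \<open>K\<close>, so
    the embeddings of \<open>K(z)\<close> correspond to the distinct roots of
    \<open>Irr K z\<close>.\<close>
  have "card (embeddings K ?M) = card (SIGMA \<phi>:embeddings K K. {a. is_root (map \<phi> (Irr K z)) a})"
    using bij_betw_same_card[OF embeddings_simple_extension_bij[OF K _ zc az]] by blast
  also have "\<dots> = card {a. is_root (Irr K z) a}"
    unfolding embeddings_self[OF K] Sigma_def using m by (simp add: card_image inj_on_def UNION_singleton_eq_range)
  finally have "card {a. is_root (Irr K z) a} = degree (Irr K z)"
    using le card_roots_le[OF I] by simp
  thus ?thesis using card_roots_eq_iff[OF I] az unfolding separable_element_def by blast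
qed

text \<open>Sums, products, negatives and inverses of separable \<open>x\<close> and
  \<open>y\<close> lie in \<open>K(x, y)\<close>, all of whose elements are separable because its
  generators are.\<close>

lemma separable_elements_subfield:
  assumes K: "subfield K L" and E: "subfield E L" and KE: "K \<subseteq> E"
  shows "subfield {x \<in> E. separable_element K x} L" "K \<subseteq> {x \<in> E. separable_element K x}"
proof -
  let ?S = "{x \<in> E. separable_element K x}"
  note ring_E = subringE[OF subfieldE(1)[OF E]]
  have EC: "E \<subseteq> carrier L" using subfieldE(3)[OF E] .
  have base: "separable_element K x" if "x \<in> K" for x
    using separable_finite_extension[OF K, of "[]" x] that by simp
  thus sub: "K \<subseteq> ?S" using KE by blast
  have gen: "separable_element K z" if x: "x \<in> ?S" and y: "y \<in> ?S" and z: "z \<in> finite_extension K [x, y]" for x y z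
    by (rule separable_finite_extension[OF K _ _ z]) (use x y EC in auto)
  have F: "subfield (finite_extension K [x, y]) L" "x \<in> finite_extension K [x, y]" "y \<in> finite_extension K [x, y]"
    if x: "x \<in> ?S" and y: "y \<in> ?S" for x y
  proof -
    have s: "set [x, y] \<subseteq> carrier L" using x y EC by auto
    have "\<And>u. u \<in> set [x, y] \<Longrightarrow> (algebraic over K) u" using x y unfolding separable_element_def by auto
    thus "subfield (finite_extension K [x, y]) L" using finite_extension_is_subfield[OF K s] by blast
    have i: "set [x, y] \<subseteq> finite_extension K [x, y]"
      using finite_extension_mem[OF subfieldE(1)[OF K] s] .
    show "x \<in> finite_extension K [x, y]" by (rule subsetD[OF i]) simp
    show "y \<in> finite_extension K [x, y]" by (rule subsetD[OF i]) simp
  qed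
  show "subfield ?S L"
  proof (rule subfieldI'[OF subringI])
    show "?S \<subseteq> carrier L" using EC by blast
    show "\<one> \<in> ?S" using sub subringE(3)[OF subfieldE(1)[OF K]] by blast
  next
    fix x assume x: "x \<in> ?S"
    thus "\<ominus> x \<in> ?S" using gen[OF x x subringE(5)[OF subfieldE(1)[OF F(1)[OF x x]] F(2)[OF x x]]] ring_E(5) by simp
  next
    fix x y assume x: "x \<in> ?S" and y: "y \<in> ?S"
    note Fs = subringE[OF subfieldE(1)[OF F(1)[OF x y]]]
    show "x \<otimes> y \<in> ?S" using gen[OF x y Fs(6)[OF F(2,3)[OF x y]]] ring_E(6) x y by simp
    show "x \<oplus> y \<in> ?S" using gen[OF x y Fs(7)[OF F(2,3)[OF x y]]] ring_E(7) x y by simp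
  next
    fix x assume x: "x \<in> ?S - {\<zero>}"
    hence xS: "x \<in> ?S" by simp
    have "inv x \<in> finite_extension K [x, x]"
      using subfield_m_inv(1)[OF F(1)[OF xS xS], of x] F(2)[OF xS xS] x by blast
    moreover have "inv x \<in> E" using subfield_m_inv(1)[OF E, of x] x by blast
    ultimately show "inv x \<in> ?S" using gen[OF xS xS] by blast
  qed
qed

text \<open>\<open>GREATEST\<close> has a usable value only once a greatest member is exhibited. The
  set of all separable elements contains every competitor and is itself a field.\<close>

lemma max_separable_subextension_eq:
  assumes K: "subfield K L" and E: "subfield E L" and KE: "K \<subseteq> E"
  shows "max_separable_subextension K E = {x \<in> E. separable_element K x}"
  unfolding max_separable_subextension_def
proof (rule Greatest_equality)
  show "intermediate_field K {x \<in> E. separable_element K x} E \<and>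
        separable_extension K {x \<in> E. separable_element K x}"
    using separable_elements_subfield[OF assms] unfolding intermediate_field_def separable_extension_def by blast
next
  fix F assume "intermediate_field K F E \<and> separable_extension K F"
  thus "F \<le> {x \<in> E. separable_element K x}"
    unfolding intermediate_field_def separable_extension_def by blast
qed

lemma card_embeddings_separable:
  assumes K: "subfield K L" and S: "subfield S L" and KS: "K \<subseteq> S" and fin: "finite_dimension K S"
    and sep: "\<And>x. x \<in> S \<Longrightarrow> separable_element K x"
  shows "card (embeddings K S) = (dim over K) S"
proof -
  obtain xs where xs: "set xs \<subseteq> S" "set xs \<subseteq> carrier L" "S = finite_extension K xs"
    by (rule finite_extension_generators[OF K K S _ KS fin]) blast+
  have "\<And>x. x \<in> set xs \<Longrightarrow> separable_element K x" using sep xs(1) by blast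
  from card_embeddings_separably_generated[OF K xs(2) this] show ?thesis unfolding xs(3) .
qed

end

section \<open>Coefficients and evaluation of list polynomials\<close>

lemma (in ring) coeff_map_rev_upt:
  "coeff (map c (rev [0..<m])) i = (if i < m then c i else \<zero>)"
  by (induction m) auto

text \<open>The summation bound may exceed the length, coefficients past the end being zero; this
  allows polynomials of different lengths to be summed over a common range.\<close>

lemma (in ring) eval_as_finsum:
  assumes p: "set p \<subseteq> carrier R" and x: "x \<in> carrier R" and "length p \<le> n"
  shows "eval p x = (\<Oplus>i\<in>{..<n}. coeff p i \<otimes> x [^] i)"
  using \<open>length p \<le> n\<close>
proof (induction n rule: dec_induct)
  case base
  show ?case using p
  proof (induction p)
    case (Cons a q)
    have q: "set q \<subseteq> carrier R" and a: "a \<in> carrier R" using Cons.prems by auto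
    have "(\<Oplus>i\<in>{..<length (a # q)}. coeff (a # q) i \<otimes> x [^] i) =
        coeff (a # q) (length q) \<otimes> x [^] length q \<oplus> (\<Oplus>i\<in>{..<length q}. coeff (a # q) i \<otimes> x [^] i)"
      using coeff_in_carrier[OF Cons.prems] x by (simp add: lessThan_Suc del: coeff.simps)
    also have "(\<Oplus>i\<in>{..<length q}. coeff (a # q) i \<otimes> x [^] i) = (\<Oplus>i\<in>{..<length q}. coeff q i \<otimes> x [^] i)"
      by (rule finsum_cong') (use coeff_in_carrier[OF q] x in auto)
    finally show ?case using Cons.IH[OF q] by simp
  qed simp
next
  case (step n)
  have "coeff p n = \<zero>" using coeff_length step.hyps(1) by blast
  thus ?case using step.IH coeff_in_carrier[OF p] x by (simp add: lessThan_Suc)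
qed

subsection \<open>Formal derivative\<close>

text \<open>Lists carry the highest coefficient first, hence the reversed range. Normalization is
  essential in positive characteristic, where the multiples \<open>[Suc i] \<cdot> c\<close> of
  leading coefficients may vanish.\<close>

definition (in ring) pderivative :: "'a list \<Rightarrow> 'a list"
  where "pderivative p = normalize (map (\<lambda>i. [Suc i] \<cdot> coeff p (Suc i)) (rev [0..<degree p]))"

context cring
begin

lemma add_pow_in_subring:
  assumes "subring K R" "k \<in> K"
  shows "[(n::nat)] \<cdot> k \<in> K"
  using subringE[OF assms(1)] assms(2) by (induction n) auto

lemma pderivative_closed:
  assumes "subring K R" "p \<in> carrier (K[X])"
  shows "pderivative p \<in> carrier (K[X])" "length (pderivative p) \<le> degree p"
proof -
  have "set p \<subseteq> K" using assms(2) polynomial_incl unfolding sym[OF univ_poly_carrier] by blast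
  hence "set p \<union> {\<zero>} \<subseteq> K" using subringE(2)[OF assms(1)] by simp
  hence c: "coeff p i \<in> K" for i
    using rangeI[of "coeff p" i] unfolding coeff_img(3) by (rule subsetD)
  have "set (map (\<lambda>i. [Suc i] \<cdot> coeff p (Suc i)) (rev [0..<degree p])) \<subseteq> K"
    using add_pow_in_subring[OF assms(1) c] by (auto simp del: add.nat_pow_Suc)
  thus "pderivative p \<in> carrier (K[X])"
    unfolding pderivative_def sym[OF univ_poly_carrier] by (rule normalize_gives_polynomial)
  show "length (pderivative p) \<le> degree p"
    unfolding pderivative_def by (rule order.trans[OF normalize_length_le]) simp
qed

lemma pderivative_eq_NilD:
  assumes "pderivative p = []" "i < degree p"
  shows "[Suc i] \<cdot> coeff p (Suc i) = \<zero>"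
proof -
  let ?l = "map (\<lambda>i. [Suc i] \<cdot> coeff p (Suc i)) (rev [0..<degree p])"
  have "coeff ?l i = coeff [] i"
    using normalize_coeff[of ?l] assms(1) unfolding pderivative_def by simp
  thus ?thesis unfolding coeff_map_rev_upt using assms(2) by simp
qed

lemma linear_mult_coeff_Suc:
  assumes "a \<in> carrier R" "set q \<subseteq> carrier R"
  shows "coeff (poly_mult [\<one>, \<ominus> a] q) (Suc i) = coeff q i \<ominus> a \<otimes> coeff q (Suc i)"
proof -
  have s: "set (map ((\<otimes>) \<one>) q @ [\<zero>]) \<subseteq> carrier R" "set (map ((\<otimes>) (\<ominus> a)) q) \<subseteq> carrier R"
    using assms by auto
  note c = coeff_in_carrier[OF assms(2)]
  have p2: "coeff (poly_add (map ((\<otimes>) (\<ominus> a)) q) []) = coeff (map ((\<otimes>) (\<ominus> a)) q)"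
    using poly_add_coeff[OF s(2), of "[]"] coeff_in_carrier[OF s(2)] by (simp add: fun_eq_iff)
  have s3: "set (poly_add (map ((\<otimes>) (\<ominus> a)) q) []) \<subseteq> carrier R" using poly_add_in_carrier[OF s(2), of "[]"] by (simp del: poly_add.simps)
  have "coeff (poly_mult [\<one>, \<ominus> a] q) (Suc i) =
      coeff (map ((\<otimes>) \<one>) q @ [\<zero>]) (Suc i) \<oplus> coeff (map ((\<otimes>) (\<ominus> a)) q) (Suc i)"
    using poly_add_coeff[OF s(1) s3] p2 by (simp del: poly_add.simps)
  also have "\<dots> = coeff q i \<oplus> (\<ominus> a) \<otimes> coeff q (Suc i)"
    using append_coeff[of "map ((\<otimes>) \<one>) q" "[\<zero>]"] scalar_coeff[of \<one> q] scalar_coeff[of "\<ominus> a" q] assms(1) c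
    by simp
  finally show ?thesis using assms(1) c by (simp add: a_minus_def l_minus)
qed

text \<open>This is the product rule for \<open>(X - a) q\<close> at the single point
  \<open>a\<close>, where the summand with the derivative of \<open>q\<close> drops out. The bound
  on the length of \<open>p\<close> lets both sums run over the indices of \<open>q\<close>.\<close>

lemma pderivative_eval_linear_mult:
  assumes a: "a \<in> carrier R" and q: "set q \<subseteq> carrier R"
    and p: "p = poly_mult [\<one>, \<ominus> a] q" "length p \<le> Suc (length q)"
  shows "eval (pderivative p) a = eval q a"
proof -
  let ?c = "\<lambda>i. coeff p i" and ?q = "\<lambda>i. coeff q i"
  have qc: "?q i \<in> carrier R" for i using coeff_in_carrier[OF q] .
  have ps: "set p \<subseteq> carrier R" unfolding p(1) using a q by (intro poly_mult_in_carrier) auto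
  have pc: "?c i \<in> carrier R" for i using coeff_in_carrier[OF ps] .
  \<comment> \<open>Summation by parts: \<open>c_(i+1) = q_i - a q_(i+1)\<close> makes the weighted
    sum telescope up to the boundary term \<open>n q_n a^n\<close>, which is zero as soon as
    \<open>n\<close> is the length of \<open>q\<close>.\<close>
  have tel: "(\<Oplus>i\<in>{..<n}. ([Suc i] \<cdot> ?c (Suc i)) \<otimes> a [^] i) \<oplus> [n] \<cdot> (?q n \<otimes> a [^] n) =
      (\<Oplus>i\<in>{..<n}. ?q i \<otimes> a [^] i)" for n
  proof (induction n)
    case 0
    show ?case using qc a by simp
  next
    case (Suc n)
    define S where "S = (\<Oplus>i\<in>{..<n}. ([Suc i] \<cdot> ?c (Suc i)) \<otimes> a [^] i)"
    define u where "u = ?q n \<otimes> a [^] n"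
    define v where "v = ?q (Suc n) \<otimes> a [^] Suc n"
    have cl: "S \<in> carrier R" "u \<in> carrier R" "v \<in> carrier R" unfolding S_def u_def v_def using pc qc a by simp_all
    have cv: "?c (Suc n) \<otimes> a [^] n = u \<ominus> v"
      unfolding p(1) linear_mult_coeff_Suc[OF a q] u_def v_def using qc a
      by (simp add: a_minus_def l_distr r_distr l_minus r_minus m_ac)
    have "(\<Oplus>i\<in>{..<Suc n}. ([Suc i] \<cdot> ?c (Suc i)) \<otimes> a [^] i) = ([Suc n] \<cdot> ?c (Suc n)) \<otimes> a [^] n \<oplus> S"
      unfolding S_def using pc a by (simp add: lessThan_Suc)
    also have "([Suc n] \<cdot> ?c (Suc n)) \<otimes> a [^] n = [Suc n] \<cdot> (u \<ominus> v)"
      using add_pow_ldistr[of "?c (Suc n)" "a [^] n" "Suc n"] pc a cv by simp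
    also have "\<dots> = [Suc n] \<cdot> u \<ominus> [Suc n] \<cdot> v"
      using add.nat_pow_distrib[OF cl(2) a_inv_closed[OF cl(3)], of "Suc n"] add.nat_pow_inv[OF cl(3), of "Suc n"]
      by (simp only: a_minus_def a_inv_def)
    finally have "(\<Oplus>i\<in>{..<Suc n}. ([Suc i] \<cdot> ?c (Suc i)) \<otimes> a [^] i) \<oplus> [Suc n] \<cdot> v =
        (([Suc n] \<cdot> u \<ominus> [Suc n] \<cdot> v) \<oplus> S) \<oplus> [Suc n] \<cdot> v" by simp
    also have "\<dots> = S \<oplus> [Suc n] \<cdot> u"
    proof -
      have "(U \<ominus> V \<oplus> S) \<oplus> V = S \<oplus> U" if "U \<in> carrier R" "V \<in> carrier R" for U V
        using that cl(1) by algebra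
      thus ?thesis using cl by simp
    qed
    also have "\<dots> = S \<oplus> [n] \<cdot> u \<oplus> u" using cl by (simp add: a_assoc)
    also have "\<dots> = (\<Oplus>i\<in>{..<n}. ?q i \<otimes> a [^] i) \<oplus> u" using Suc.IH unfolding S_def u_def by simp
    also have "\<dots> = (\<Oplus>i\<in>{..<Suc n}. ?q i \<otimes> a [^] i)"
      unfolding u_def using qc a by (simp add: lessThan_Suc a_comm)
    finally show ?case unfolding v_def .
  qed
  let ?n = "length q"
  let ?l = "map (\<lambda>i. [Suc i] \<cdot> ?c (Suc i)) (rev [0..<degree p])"
  have "?q ?n = \<zero>" using coeff_length[of q ?n] by simp
  hence "(\<Oplus>i\<in>{..<?n}. ([Suc i] \<cdot> ?c (Suc i)) \<otimes> a [^] i) = eval q a"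
    using tel[of ?n] eval_as_finsum[OF q a, of ?n] pc a by simp
  moreover have ls: "set ?l \<subseteq> carrier R" using pc by auto
  moreover have "eval (pderivative p) a = (\<Oplus>i\<in>{..<?n}. coeff ?l i \<otimes> a [^] i)"
    unfolding pderivative_def eval_normalize[OF ls a]
    by (rule eval_as_finsum[OF ls a]) (use p(2) in simp)
  moreover have "coeff ?l i = [Suc i] \<cdot> ?c (Suc i)" for i
    unfolding coeff_map_rev_upt using coeff_length[of p "Suc i"] by (simp del: add.nat_pow_Suc)
  ultimately show ?thesis by simp
qed

subsection \<open>The Frobenius map\<close>

lemma binomial:
  assumes a: "a \<in> carrier R" and b: "b \<in> carrier R"
  shows "(a \<oplus> b) [^] n = (\<Oplus>k\<in>{..n}. [(n choose k)] \<cdot> (a [^] k \<otimes> b [^] (n - k)))"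
proof (induction n)
  case 0
  show ?case using a b by simp
next
  case (Suc n)
  let ?f = "\<lambda>k. [(n choose k)] \<cdot> (a [^] Suc k \<otimes> b [^] (n - k))"
  let ?g = "\<lambda>k. [(n choose k)] \<cdot> (a [^] k \<otimes> b [^] (Suc n - k))"
  let ?h = "\<lambda>k. [(n choose (Suc k))] \<cdot> (a [^] Suc k \<otimes> b [^] (n - k))"
  let ?s = "\<lambda>k. [(n choose k)] \<cdot> (a [^] k \<otimes> b [^] (n - k))"
  have sc: "?s k \<in> carrier R" for k using a b by simp
  have fc: "?f k \<in> carrier R" and gc: "?g k \<in> carrier R" and hc: "?h k \<in> carrier R" for k
    using a b by (simp_all del: nat_pow_Suc)
  have sf: "?s k \<otimes> a = ?f k" for k
    using a b by (simp add: add_pow_rdistr m_ac)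
  have sg: "?s k \<otimes> b = ?g k" if "k \<le> n" for k
    using a b that by (simp add: add_pow_rdistr Suc_diff_le m_ac)
  have "(a \<oplus> b) [^] Suc n = (\<Oplus>k\<in>{..n}. ?s k) \<otimes> a \<oplus> (\<Oplus>k\<in>{..n}. ?s k) \<otimes> b"
    using Suc.IH a b sc by (simp add: r_distr)
  also have "(\<Oplus>k\<in>{..n}. ?s k) \<otimes> a = (\<Oplus>k\<in>{..n}. ?f k)"
    using finsum_ldistr[of "{..n}" a ?s] a sc sf by simp
  also have "(\<Oplus>k\<in>{..n}. ?s k) \<otimes> b = (\<Oplus>k\<in>{..n}. ?g k)"
  proof -
    have "(\<Oplus>k\<in>{..n}. ?s k) \<otimes> b = (\<Oplus>k\<in>{..n}. ?s k \<otimes> b)" using finsum_ldistr[of "{..n}" b ?s] b sc by simp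
    also have "\<dots> = (\<Oplus>k\<in>{..n}. ?g k)" by (rule finsum_cong') (use sg gc in auto)
    finally show ?thesis .
  qed
  \<comment> \<open>The additional term has coefficient \<open>n choose Suc n = 0\<close>. After it
    is added, splitting off \<open>k = 0\<close> shifts the index, and the shifted terms combine
    with \<open>?f\<close> by Pascal's rule.\<close>
  also have "(\<Oplus>k\<in>{..n}. ?g k) = (\<Oplus>k\<in>{..Suc n}. ?g k)"
    using finsum_Suc[of ?g n] finsum_closed[of ?g "{..n}"] gc a b
    by (simp add: Pi_def binomial_eq_0 del: nat_pow_Suc)
  also have "\<dots> = (\<Oplus>k\<in>{..n}. ?h k) \<oplus> ?g 0"
    using finsum_Suc2[of ?g n] gc by (simp add: Pi_def del: nat_pow_Suc)
  finally have L: "(a \<oplus> b) [^] Suc n = (\<Oplus>k\<in>{..n}. ?f k) \<oplus> ((\<Oplus>k\<in>{..n}. ?h k) \<oplus> ?g 0)" .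
  let ?r = "\<lambda>k. [(Suc n choose k)] \<cdot> (a [^] k \<otimes> b [^] (Suc n - k))"
  have rc: "?r k \<in> carrier R" for k using a b by simp
  have "?r (Suc k) = ?f k \<oplus> ?h k" for k
    using a b add.nat_pow_mult[of "a [^] Suc k \<otimes> b [^] (n - k)" "n choose k" "n choose Suc k"]
    by (simp del: nat_pow_Suc)
  moreover have "?r 0 = ?g 0" by simp
  ultimately have "(\<Oplus>k\<in>{..Suc n}. ?r k) = (\<Oplus>k\<in>{..n}. ?f k \<oplus> ?h k) \<oplus> ?g 0"
    using finsum_Suc2[of ?r n] rc by (simp add: Pi_def del: nat_pow_Suc)
  also have "(\<Oplus>k\<in>{..n}. ?f k \<oplus> ?h k) = (\<Oplus>k\<in>{..n}. ?f k) \<oplus> (\<Oplus>k\<in>{..n}. ?h k)"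
    using finsum_addf[of ?f "{..n}" ?h] fc hc by (simp add: Pi_def del: nat_pow_Suc)
  finally have R: "(\<Oplus>k\<in>{..Suc n}. ?r k) = (\<Oplus>k\<in>{..n}. ?f k) \<oplus> (\<Oplus>k\<in>{..n}. ?h k) \<oplus> ?g 0" .
  have "(\<Oplus>k\<in>{..n}. ?f k) \<in> carrier R" "(\<Oplus>k\<in>{..n}. ?h k) \<in> carrier R"
    using fc hc by (intro finsum_closed funcsetI; blast)+
  thus ?case unfolding L R by (rule a_assoc[OF _ _ gc, symmetric])
qed

lemma add_pow_mult_eq_zero:
  assumes "[(p::nat)] \<cdot> \<one> = \<zero>" "p dvd k" "a \<in> carrier R"
  shows "[k] \<cdot> a = \<zero>"
proof -
  obtain m where k: "k = p * m" using assms(2) by blast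
  have "[k] \<cdot> a = [m] \<cdot> ([p] \<cdot> a)" unfolding k using add.nat_pow_pow[OF assms(3)] by simp
  also have "[p] \<cdot> a = ([p] \<cdot> \<one>) \<otimes> a" using add_pow_ldistr[of \<one> a p] assms(3) by simp
  finally show ?thesis using assms(1,3) by simp
qed

text \<open>The inner binomial coefficients are divisible by the prime \<open>p\<close>, so only the
  two extreme terms survive.\<close>

lemma frobenius_add:
  assumes p: "prime (p::nat)" "[p] \<cdot> \<one> = \<zero>" and a: "a \<in> carrier R" and b: "b \<in> carrier R"
  shows "(a \<oplus> b) [^] p = a [^] p \<oplus> b [^] p"
proof -
  let ?t = "\<lambda>k. [(p choose k)] \<cdot> (a [^] k \<otimes> b [^] (p - k))"
  have tc: "?t k \<in> carrier R" for k using a b by simp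
  obtain m where m: "p = Suc m" using prime_gt_0_nat[OF p(1)] gr0_conv_Suc by blast
  have z: "?t k = \<zero>" if "0 < k" "k < p" for k
    using add_pow_mult_eq_zero[OF p(2) dvd_choose_prime[OF _ _ _ p(1), of k]] that a b by simp
  have "(\<Oplus>k\<in>{..p}. ?t k) = ?t p \<oplus> (\<Oplus>k\<in>{..m}. ?t k)"
    unfolding m using finsum_Suc[of ?t m] tc unfolding m by (simp add: Pi_def)
  also have "(\<Oplus>k\<in>{..m}. ?t k) = (\<Oplus>k\<in>{0}. ?t k)"
    by (rule add.finprod_mono_neutral_cong_right) (use z tc m in auto)
  finally show ?thesis using binomial[OF a b, of p] a b by simp
qed

end

context domain
begin

text \<open>Additivity applied to \<open>x = (x - y) + y\<close> turns \<open>x^p = y^p\<close> into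
  \<open>(x - y)^p = 0\<close>, and a domain has no nilpotent elements.\<close>

lemma frobenius_inj:
  assumes p: "prime (p::nat)" "[p] \<cdot> \<one> = \<zero>"
  shows "inj_on (\<lambda>x. x [^] p) (carrier R)"
proof (rule inj_onI)
  fix x y assume x: "x \<in> carrier R" and y: "y \<in> carrier R" and e: "x [^] p = y [^] p"
  have "x [^] p = ((x \<ominus> y) \<oplus> y) [^] p" using x y by (simp add: a_minus_def a_assoc l_neg)
  also have "\<dots> = (x \<ominus> y) [^] p \<oplus> y [^] p" using frobenius_add[OF p] x y by simp
  finally have "(x \<ominus> y) [^] p \<oplus> y [^] p = \<zero> \<oplus> y [^] p" using e y by simp
  hence z: "(x \<ominus> y) [^] p = \<zero>" using add.right_cancel[of "y [^] p" "(x \<ominus> y) [^] p" \<zero>] x y by simp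
  have nz: "u = \<zero>" if "u \<in> carrier R" "u [^] n = \<zero>" for u and n :: nat
    using that by (induction n) (auto simp: integral_iff)
  have "x \<ominus> y = \<zero>" by (rule nz[OF _ z]) (use x y in simp)
  thus "x = y" using r_right_minus_eq[OF x y] by simp
qed

lemma add_pow_eq_zeroD:
  assumes "[(k::nat)] \<cdot> c = \<zero>" "c \<in> carrier R" "c \<noteq> \<zero>"
  shows "[k] \<cdot> \<one> = \<zero>"
proof -
  have "([k] \<cdot> \<one>) \<otimes> c = \<zero>" using add_pow_ldistr[of \<one> c k] assms(1,2) by simp
  thus ?thesis using assms(2,3) integral[of "[k] \<cdot> \<one>" c] by auto
qed

text \<open>The least positive annihilator of \<open>\<one>\<close> is prime because a proper
  factorization would produce zero divisors; it divides every other annihilator because the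
  remainder is a smaller one.\<close>

lemma exists_prime_characteristic:
  assumes n: "[(n::nat)] \<cdot> \<one> = \<zero>" "n > 0"
  obtains p where "prime p" "[p] \<cdot> \<one> = \<zero>" "\<And>i::nat. [i] \<cdot> \<one> = \<zero> \<Longrightarrow> p dvd i"
proof -
  define p where "p = (LEAST p::nat. p > 0 \<and> [p] \<cdot> \<one> = \<zero>)"
  have p: "p > 0" "[p] \<cdot> \<one> = \<zero>" using LeastI[of "\<lambda>p::nat. p > 0 \<and> [p] \<cdot> \<one> = \<zero>" n] n unfolding p_def by blast+
  have least: "p \<le> i" if "i > 0" "[i] \<cdot> \<one> = \<zero>" for i :: nat
    using Least_le[of "\<lambda>p::nat. p > 0 \<and> [p] \<cdot> \<one> = \<zero>" i] that unfolding p_def by blast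
  have mult: "[(a * b)] \<cdot> \<one> = ([a] \<cdot> \<one>) \<otimes> ([b] \<cdot> \<one>)" for a b :: nat
  proof -
    have "[(a * b)] \<cdot> \<one> = [a] \<cdot> ([b] \<cdot> \<one>)"
      unfolding add.nat_pow_pow[OF one_closed] by (simp only: mult.commute)
    thus ?thesis using add_pow_ldistr[of \<one> "[b] \<cdot> \<one>" a] by simp
  qed
  have "p \<noteq> 1" using p(2) one_not_zero by auto
  moreover have "m = 1 \<or> m = p" if md: "m dvd p" for m
  proof -
    obtain l where l: "p = m * l" using md by blast
    hence pos: "m > 0" "l > 0" using p(1) by auto
    have "[m] \<cdot> \<one> = \<zero> \<or> [l] \<cdot> \<one> = \<zero>" using mult[of m l] p(2) l integral[of "[m] \<cdot> \<one>" "[l] \<cdot> \<one>"] by simp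
    hence "p \<le> m \<or> p \<le> l" using least pos by blast
    thus ?thesis
    proof
      assume "p \<le> m" thus ?thesis using dvd_imp_le[OF md p(1)] by simp
    next
      assume "p \<le> l"
      hence "m * l \<le> 1 * l" using l by simp
      thus ?thesis using pos by auto
    qed
  qed
  ultimately have "prime p" using p(1) unfolding prime_nat_iff by auto
  moreover have "p dvd i" if i: "[i] \<cdot> \<one> = \<zero>" for i :: nat
  proof -
    have "[i] \<cdot> \<one> = [(p * (i div p))] \<cdot> \<one> \<oplus> [(i mod p)] \<cdot> \<one>"
      using add.nat_pow_mult[of \<one> "p * (i div p)" "i mod p"] by simp
    hence "[(i mod p)] \<cdot> \<one> = \<zero>" using i mult[of p "i div p"] p(2) by simp
    hence "i mod p = 0" using least[of "i mod p"] mod_less_divisor[OF p(1), of i] by fastforce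
    thus ?thesis by auto
  qed
  ultimately show thesis using that p(2) by blast
qed

end

subsection \<open>Inseparable elements\<close>

context algebraically_closed
begin

lemma Irr_eqI:
  assumes K: "subfield K L" and x: "x \<in> carrier L" "(algebraic over K) x"
    and c: "c \<in> carrier L" "eval (Irr K x) c = \<zero>"
  shows "(algebraic over K) c" "Irr K c = Irr K x"
proof -
  note I = IrrE[OF K x]
  show a: "(algebraic over K) c"
    using algebraicI[OF I(1) Irr_in_poly_ring(2)[OF K x] c(2)] .
  have "\<exists>!p. p \<in> carrier (K[X]) \<and> pirreducible K p \<and> eval p c = \<zero> \<and> lead_coeff p = \<one>"
    using minimal_polynomial_is_unique[OF K c(1) a] by simp
  thus "Irr K c = Irr K x"
    using I c(2) IrrE[OF K c(1) a] by blast
qed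

lemma Irr_degree_le:
  assumes K: "subfield K L" and x: "x \<in> carrier L"
    and p: "p \<in> carrier (K[X])" "p \<noteq> []" "eval p x = \<zero>"
  shows "(algebraic over K) x" "degree (Irr K x) \<le> degree p"
proof -
  show a: "(algebraic over K) x" using algebraicI[OF p] .
  show "degree (Irr K x) \<le> degree p"
    using pdivides_imp_degree_le[OF subfieldE(1)[OF K] IrrE(1)[OF K x a] p(1,2) Irr_minimal[OF K x a p(1,3)]] .
qed

text \<open>Write \<open>p = (X - c) q\<close> with \<open>q = (X - c) r\<close>. The derivative of
  \<open>p\<close> takes at \<open>c\<close> the value \<open>q(c)\<close>, which is zero.\<close>

lemma multiple_root_pderivative:
  assumes p: "p \<in> carrier (poly_ring L)" "p \<noteq> []" and c: "c \<in> carrier L" and m: "alg_mult p c \<ge> 2"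
  shows "eval p c = \<zero>" "eval (pderivative p) c = \<zero>"
proof -
  interpret UP: domain "poly_ring L" using univ_poly_is_domain[OF carrier_is_subring] .
  let ?l = "[\<one>, \<ominus> c]"
  have l: "?l \<in> carrier (poly_ring L)"
    using c unfolding sym[OF univ_poly_carrier] polynomial_def by simp
  have "?l [^]\<^bsub>poly_ring L\<^esub> (2::nat) pdivides p" using le_alg_mult_imp_pdivides[OF c p(1) m] .
  then obtain r where r: "r \<in> carrier (poly_ring L)" "p = ?l [^]\<^bsub>poly_ring L\<^esub> (2::nat) \<otimes>\<^bsub>poly_ring L\<^esub> r"
    unfolding pdivides_def by (auto elim: dividesE)
  define q where "q = ?l \<otimes>\<^bsub>poly_ring L\<^esub> r"
  have q: "q \<in> carrier (poly_ring L)" unfolding q_def using l r by simp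
  have pq: "p = ?l \<otimes>\<^bsub>poly_ring L\<^esub> q"
    unfolding q_def r(2) using l r(1) by (simp add: numeral_2_eq_2 UP.m_assoc)
  note h = eval_is_hom[OF carrier_is_subring c]
  have el: "eval ?l c = \<zero>" using c by (simp add: r_neg)
  have "eval r c \<in> carrier L" "eval q c \<in> carrier L"
    using ring_hom_memE(1)[OF h] r(1) q by blast+
  moreover have "eval q c = eval ?l c \<otimes> eval r c" unfolding q_def using ring_hom_memE(2)[OF h l r(1)] .
  moreover have "eval p c = eval ?l c \<otimes> eval q c" unfolding pq using ring_hom_memE(2)[OF h l q] .
  ultimately have e0: "eval q c = \<zero>" "eval p c = \<zero>" unfolding el by simp_all
  show "eval p c = \<zero>" using e0(2) .
  have qn: "q \<noteq> []"
  proof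
    assume "q = []"
    hence "p = []" unfolding pq using l UP.r_null unfolding univ_poly_zero by simp
    thus False using p(2) by simp
  qed
  have "degree p = Suc (degree q)"
    using poly_mult_degree_eq[OF carrier_is_subring, of ?l q] l q qn
    unfolding pq univ_poly_mult univ_poly_carrier by simp
  moreover have "length q \<ge> 1" using qn by (cases q) auto
  ultimately have len: "length p \<le> Suc (length q)" by linarith
  have "set q \<subseteq> carrier L" using q polynomial_incl unfolding sym[OF univ_poly_carrier] by blast
  from pderivative_eval_linear_mult[OF c this _ len] pq
  show "eval (pderivative p) c = \<zero>" using e0(1) unfolding univ_poly_mult by simp
qed

text \<open>A multiple root \<open>c\<close> of \<open>Irr K x\<close> has the same minimal
  polynomial as \<open>x\<close>. The derivative also has coefficients in \<open>K\<close>, vanishes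
  at \<open>c\<close> and has smaller degree, so it must be zero.\<close>

lemma inseparable_imp_pderivative_zero:
  assumes K: "subfield K L" and x: "x \<in> carrier L" "(algebraic over K) x"
    and ns: "\<not> separable_element K x"
  shows "pderivative (Irr K x) = []"
proof (rule ccontr)
  let ?f = "Irr K x"
  note I = Irr_in_poly_ring[OF K x] and If = IrrE(1)[OF K x]
  assume nz: "pderivative ?f \<noteq> []"
  obtain c where c: "c \<in> carrier L" "alg_mult ?f c \<ge> 2"
    using ns x(2) unfolding separable_element_def by fastforce
  note m = multiple_root_pderivative[OF I(1,2) c]
  note d = pderivative_closed[OF subfieldE(1)[OF K] If]
  have "degree ?f \<le> degree (pderivative ?f)"
    using Irr_degree_le(2)[OF K c(1) d(1) nz m(2)] unfolding Irr_eqI(2)[OF K x c(1) m(1)] .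
  thus False using d(2) I(3) nz by (cases "pderivative ?f") auto
qed

text \<open>If the minimal polynomial \<open>f\<close> of \<open>x\<close> has zero derivative, then \<open>f = g(X^p)\<close>.\<close>

lemma inseparable_imp_degree_power_less:
  assumes K: "subfield K L" and x: "x \<in> carrier L" "(algebraic over K) x"
    and ns: "\<not> separable_element K x"
  obtains p :: nat where "prime p" "[p] \<cdot> \<one> = \<zero>" "(algebraic over K) (x [^] p)"
    "degree (Irr K (x [^] p)) < degree (Irr K x)"
proof -
  let ?f = "Irr K x"
  let ?n = "degree ?f"
  note I = Irr_in_poly_ring[OF K x] and If = IrrE[OF K x]
  have co: "[i] \<cdot> coeff ?f i = \<zero>" for i
  proof (cases i)
    case (Suc j)
    show ?thesis
    proof (cases "j < ?n")
      case True
      thus ?thesis using pderivative_eq_NilD[OF inseparable_imp_pderivative_zero[OF assms]] Suc by blast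
    next
      case False
      hence "coeff ?f i = \<zero>" using coeff_degree[of ?f i] Suc by simp
      thus ?thesis by simp
    qed
  qed simp
  have lead: "coeff ?f ?n = \<one>" using lead_coeff_simp[OF I(2)] If(3) by simp
  have sK: "set ?f \<subseteq> K" using If(1) polynomial_incl unfolding sym[OF univ_poly_carrier] by blast
  hence sL: "set ?f \<subseteq> carrier L" using subfieldE(3)[OF K] by blast
  note cL = coeff_in_carrier[OF sL]
  have cK: "coeff ?f i \<in> K" for i
  proof -
    have "set ?f \<union> {\<zero>} \<subseteq> K" using sK subringE(2)[OF subfieldE(1)[OF K]] by simp
    thus ?thesis using rangeI[of "coeff ?f" i] unfolding coeff_img(3) by (rule subsetD)
  qed
  \<comment> \<open>The polynomial is monic, so the vanishing of \<open>n\<close> times its leading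
    coefficient says that the degree \<open>n\<close> annihilates \<open>\<one>\<close>. This is
    where the characteristic comes from.\<close>
  have n1: "[?n] \<cdot> \<one> = \<zero>" using co[of ?n] unfolding lead .
  have n0: "?n > 0" using I(3) by simp
  obtain p where p: "prime (p::nat)" "[p] \<cdot> \<one> = \<zero>" "\<And>i::nat. [i] \<cdot> \<one> = \<zero> \<Longrightarrow> p dvd i"
    by (rule exists_prime_characteristic[OF n1 n0]) blast
  have pd: "p dvd i" if "coeff ?f i \<noteq> \<zero>" for i
    using p(3)[OF add_pow_eq_zeroD[OF co cL that]] .
  have "p dvd ?n" using pd[of ?n] lead one_not_zero by simp
  then obtain m where m: "?n = p * m" by (elim dvdE)
  have p1: "p > 1" using prime_gt_1_nat[OF p(1)] .
  \<comment> \<open>Only the coefficients at multiples of \<open>p\<close> are kept. Since the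
    degree is \<open>p * m\<close>, the index \<open>m\<close> picks the leading coefficient, and
    \<open>g\<close> is monic of degree \<open>m\<close>.\<close>
  define g where "g = map (\<lambda>j. coeff ?f (p * j)) (rev [0..<Suc m])"
  have y: "x [^] p \<in> carrier L" using x(1) by simp
  have gl: "length g = Suc m" unfolding g_def by simp
  have hd: "hd g = \<one>" unfolding g_def using lead m by simp
  have gn: "g \<noteq> []" using gl by auto
  have gK: "set g \<subseteq> K" unfolding g_def using cK by auto
  hence gX: "g \<in> carrier (K[X])" using hd unfolding sym[OF univ_poly_carrier] polynomial_def by simp
  have gL: "set g \<subseteq> carrier L" using gK subfieldE(3)[OF K] by blast
  have "eval g (x [^] p) = (\<Oplus>j\<in>{..<Suc m}. coeff g j \<otimes> (x [^] p) [^] j)"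
    by (rule eval_as_finsum[OF gL y]) (simp add: gl)
  also have "\<dots> = (\<Oplus>j\<in>{..<Suc m}. coeff ?f (p * j) \<otimes> x [^] (p * j))"
    by (rule finsum_cong') (use cL x(1) in \<open>auto simp: g_def coeff_map_rev_upt nat_pow_pow simp del: upt_Suc\<close>)
  also have "\<dots> = (\<Oplus>i\<in>(\<lambda>j. p * j) ` {..<Suc m}. coeff ?f i \<otimes> x [^] i)"
    by (rule finsum_reindex[symmetric]) (use cL x(1) p1 in \<open>auto simp: inj_on_def\<close>)
  \<comment> \<open>By \<open>pd\<close>, the exponents that are not multiples of \<open>p\<close>
    contribute nothing.\<close>
  also have "\<dots> = (\<Oplus>i\<in>{..<Suc ?n}. coeff ?f i \<otimes> x [^] i)"
  proof (rule add.finprod_mono_neutral_cong_left)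
    show "(\<lambda>j. p * j) ` {..<Suc m} \<subseteq> {..<Suc ?n}" unfolding m by (auto simp: less_Suc_eq_le)
    fix i assume i: "i \<in> {..<Suc ?n} - (\<lambda>j. p * j) ` {..<Suc m}"
    have "coeff ?f i = \<zero>"
    proof (rule ccontr)
      assume "coeff ?f i \<noteq> \<zero>"
      then obtain j where j: "i = p * j" using pd by (meson dvdE)
      hence "j < Suc m" using i p1 unfolding m by (simp add: less_Suc_eq_le)
      thus False using i j by blast
    qed
    thus "coeff ?f i \<otimes> x [^] i = \<zero>" using x(1) by simp
  qed (use cL x(1) in auto)
  also have "\<dots> = eval ?f x"
    by (rule eval_as_finsum[OF sL x(1), symmetric]) simp
  finally have "eval g (x [^] p) = \<zero>" using If(4) by simp
  note D = Irr_degree_le[OF K y gX gn this]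
  have "m > 0" using m n0 by (cases m) auto
  hence "1 * m < p * m" using p1 by simp
  hence "m < ?n" using m by simp
  hence "degree (Irr K (x [^] p)) < ?n" using D(2) gl by simp
  from that[OF p(1,2) D(1) this] show thesis .
qed

text \<open>Passing from an inseparable \<open>x\<close> to \<open>x^p\<close> lowers the degree of
  the minimal polynomial, so the process stops. Injectivity of the power map is what makes it
  possible to return from \<open>x^q\<close> to \<open>x\<close>; it is inherited from Frobenius by
  composition.\<close>

lemma exists_separable_power:
  assumes K: "subfield K L" and "x \<in> carrier L" "(algebraic over K) x"
  shows "\<exists>q::nat. inj_on (\<lambda>y. y [^] q) (carrier L) \<and> separable_element K (x [^] q)"
  using assms(2,3)
proof (induction "degree (Irr K x)" arbitrary: x rule: less_induct)
  case less
  show ?case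
  proof (cases "separable_element K x")
    case True
    thus ?thesis using less.prems(1) by (intro exI[of _ 1]) (simp add: inj_on_def)
  next
    case False
    then obtain p :: nat where p: "prime p" "[p] \<cdot> \<one> = \<zero>" "(algebraic over K) (x [^] p)"
      "degree (Irr K (x [^] p)) < degree (Irr K x)"
      by (rule inseparable_imp_degree_power_less[OF K less.prems])
    have xp: "x [^] p \<in> carrier L" using less.prems(1) by simp
    obtain q :: nat where q: "inj_on (\<lambda>y. y [^] q) (carrier L)" "separable_element K ((x [^] p) [^] q)"
      using less.hyps[OF p(4) xp p(3)] by blast
    have "inj_on (\<lambda>y. y [^] (p * q)) (carrier L)"
    proof (rule inj_onI)
      fix u v assume u: "u \<in> carrier L" and v: "v \<in> carrier L" and e: "u [^] (p * q) = v [^] (p * q)"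
      have "(u [^] p) [^] q = (v [^] p) [^] q" using e nat_pow_pow u v by simp
      hence "u [^] p = v [^] p" using inj_onD[OF q(1)] u v by simp
      thus "u = v" using inj_onD[OF frobenius_inj[OF p(1,2)]] u v by simp
    qed
    moreover have "separable_element K (x [^] (p * q))" using q(2) nat_pow_pow[OF less.prems(1)] by simp
    ultimately show ?thesis by blast
  qed
qed

lemma hom_nat_pow:
  assumes "subring E L" "\<phi> \<in> ring_hom (L\<lparr>carrier := E\<rparr>) L" "x \<in> E"
  shows "x [^] (n::nat) \<in> E" "\<phi> (x [^] n) = \<phi> x [^] n"
proof -
  have E: "x [^] n \<in> E" for n :: nat
    using subringE(3,6)[OF assms(1)] assms(3) by (induction n) auto
  show "x [^] n \<in> E" using E .
  show "\<phi> (x [^] n) = \<phi> x [^] n"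
    using ring_hom_memE(2,4)[OF assms(2)] E assms(3) by (induction n) auto
qed

text \<open>The two maps agree at the separable element \<open>x^q\<close>, so the images of
  \<open>x\<close> have equal \<open>q\<close>-th powers and coincide. \<open>F\<close> is kept
  apart from the domain \<open>E\<close> because the lemma is applied both to the fixed field and to
  \<open>E\<close> itself.\<close>

lemma hom_eq_of_eq_on_separable:
  assumes K: "subfield K L" and E: "subfield E L" and F: "subfield F L" "F \<subseteq> E"
    and \<phi>: "\<phi> \<in> ring_hom (L\<lparr>carrier := E\<rparr>) L" and \<psi>: "\<psi> \<in> ring_hom (L\<lparr>carrier := E\<rparr>) L"
    and eq: "\<And>x. x \<in> F \<Longrightarrow> separable_element K x \<Longrightarrow> \<phi> x = \<psi> x"
    and x: "x \<in> F" "(algebraic over K) x"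
  shows "\<phi> x = \<psi> x"
proof -
  have xE: "x \<in> E" using F(2) x(1) by blast
  have xL: "x \<in> carrier L" using subfieldE(3)[OF F(1)] x(1) by blast
  obtain q :: nat where q: "inj_on (\<lambda>y. y [^] q) (carrier L)" "separable_element K (x [^] q)"
    using exists_separable_power[OF K xL x(2)] by blast
  have id: "id \<in> ring_hom (L\<lparr>carrier := F\<rparr>) L"
    using subfieldE(3)[OF F(1)] by (auto intro!: ring_hom_memI)
  have "x [^] q \<in> F" using hom_nat_pow(1)[OF subfieldE(1)[OF F(1)] id x(1)] .
  hence "\<phi> x [^] q = \<psi> x [^] q"
    using eq[OF _ q(2)] hom_nat_pow(2)[OF subfieldE(1)[OF E] \<phi> xE] hom_nat_pow(2)[OF subfieldE(1)[OF E] \<psi> xE] by simp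
  thus ?thesis
    using inj_onD[OF q(1)] ring_hom_memE(1)[OF \<phi>, of x] ring_hom_memE(1)[OF \<psi>, of x] xE by simp
qed

end

subsection \<open>Embeddings with the same image\<close>

lemma (in domain) finprod_eq_zeroD:
  assumes "finite A" "f \<in> A \<rightarrow> carrier R" "finprod R f A = \<zero>"
  shows "\<exists>a\<in>A. f a = \<zero>"
  using assms
proof (induction A rule: finite_induct)
  case (insert a A)
  have fa: "f a \<in> carrier R" and fA: "f \<in> A \<rightarrow> carrier R" using insert.prems(1) by auto
  have "f a \<otimes> finprod R f A = \<zero>" using insert.prems(2) finprod_insert[OF insert.hyps fA fa] by simp
  hence "f a = \<zero> \<or> finprod R f A = \<zero>" using integral[OF _ fa finprod_closed[OF fA]] by simp
  thus ?case using insert.IH[OF fA] by blast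
qed simp

lemma (in domain) linear_poly_closed:
  assumes "subring M R" "y \<in> M"
  shows "[\<one>, \<ominus> y] \<in> carrier (M[X])"
  using subringE(3,5)[OF assms(1)] assms(2) unfolding sym[OF univ_poly_carrier] polynomial_def by simp

context algebraically_closed
begin

lemma isos_over_iff:
  assumes E: "subfield E L" and F: "F \<subseteq> carrier L"
  shows "\<phi> \<in> isos_over K E F \<longleftrightarrow>
    \<phi> \<in> ring_hom (L\<lparr>carrier := E\<rparr>) L \<and> (\<forall>k\<in>K. \<phi> k = k) \<and> \<phi> ` E = F"
proof
  assume "\<phi> \<in> isos_over K E F"
  hence h: "\<phi> \<in> ring_hom (L\<lparr>carrier := E\<rparr>) (L\<lparr>carrier := F\<rparr>)" "bij_betw \<phi> E F" "\<forall>k\<in>K. \<phi> k = k"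
    unfolding isos_over_def ring_iso_def by auto
  have "\<phi> \<in> ring_hom (L\<lparr>carrier := E\<rparr>) L"
    using h(1) F unfolding ring_hom_def by auto
  thus "\<phi> \<in> ring_hom (L\<lparr>carrier := E\<rparr>) L \<and> (\<forall>k\<in>K. \<phi> k = k) \<and> \<phi> ` E = F"
    using h(2,3) unfolding bij_betw_def by simp
next
  assume h: "\<phi> \<in> ring_hom (L\<lparr>carrier := E\<rparr>) L \<and> (\<forall>k\<in>K. \<phi> k = k) \<and> \<phi> ` E = F"
  hence "bij_betw \<phi> E F" using subfield_hom_inj[OF E] unfolding bij_betw_def by blast
  moreover have "\<phi> \<in> ring_hom (L\<lparr>carrier := E\<rparr>) (L\<lparr>carrier := F\<rparr>)"
    using h unfolding ring_hom_def by auto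
  ultimately show "\<phi> \<in> isos_over K E F" using h unfolding isos_over_def ring_iso_def by simp
qed

lemma Aut_over_eq:
  assumes E: "subfield E L"
  shows "Aut_over K E = {\<phi> \<in> embeddings K E. \<phi> ` E = E}"
  using isos_over_iff[OF E subfieldE(3)[OF E]] unfolding Aut_over_def embeddings_def by blast

text \<open>The finite set \<open>S\<close> of roots of \<open>Irr K y\<close> in \<open>E\<close>
  is respected by both maps: \<open>\<phi>(S)\<close> lies in \<open>\<psi>(S)\<close>, and
  injectivity gives both sets the size of \<open>S\<close>. With the identity for
  \<open>\<psi>\<close>, an embedding of \<open>E\<close> into itself becomes an
  automorphism.\<close>

lemma embedding_image_eq_of_subset:
  assumes K: "subfield K L" and E: "subfield E L" and KE: "K \<subseteq> E"
    and alg: "\<And>x. x \<in> E \<Longrightarrow> (algebraic over K) x"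
    and \<phi>: "\<phi> \<in> embeddings K E" and \<psi>: "\<psi> \<in> embeddings K E" and sub: "\<phi> ` E \<subseteq> \<psi> ` E"
  shows "\<phi> ` E = \<psi> ` E"
proof (rule equalityI[OF sub subsetI])
  fix z assume "z \<in> \<psi> ` E"
  then obtain y where y: "y \<in> E" "z = \<psi> y" by (elim imageE)
  have yL: "y \<in> carrier L" using y(1) subfieldE(3)[OF E] by blast
  note I = IrrE[OF K yL alg[OF y(1)]]
  let ?f = "Irr K y"
  have "set ?f \<subseteq> K" using I(1) polynomial_incl unfolding sym[OF univ_poly_carrier] by blast
  hence m: "map \<theta> ?f = ?f" if "\<theta> \<in> embeddings K E" for \<theta>
    using embeddingsD(2)[OF that] by (simp add: map_idI subset_iff)
  have hev: "\<theta> (eval ?f w) = eval ?f (\<theta> w)" if "\<theta> \<in> embeddings K E" "w \<in> E" for \<theta> w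
    using hom_eval[OF E embeddingsD(1)[OF that(1)] univ_poly_carrier_mono[OF KE I(1)] that(2)] m[OF that(1)] by simp
  have h0: "\<theta> \<zero> = \<zero>" if "\<theta> \<in> embeddings K E" for \<theta>
    using embeddingsD(2)[OF that] subringE(2)[OF subfieldE(1)[OF K]] by blast
  define S where "S = {w \<in> E. eval ?f w = \<zero>}"
  have "S \<subseteq> {a. is_root ?f a}"
    using Irr_in_poly_ring(2)[OF K yL alg[OF y(1)]] subfieldE(3)[OF E] unfolding S_def is_root_def by auto
  hence fS: "finite S"
    using finite_number_of_roots[OF Irr_in_poly_ring(1)[OF K yL alg[OF y(1)]]] finite_subset by blast
  note inj = inj_on_subset[OF subfield_hom_inj[OF E embeddingsD(1)], of _ K S]
  have SE: "S \<subseteq> E" unfolding S_def by blast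
  have "\<phi> ` S \<subseteq> \<psi> ` S"
  proof (rule image_subsetI)
    fix w assume w: "w \<in> S"
    then obtain v where v: "v \<in> E" "\<phi> w = \<psi> v" using sub SE by blast
    have "\<psi> (eval ?f v) = \<phi> (eval ?f w)" using hev[OF \<phi>, of w] hev[OF \<psi> v(1)] v(2) w SE by auto
    also have "\<dots> = \<psi> \<zero>" using w h0[OF \<phi>] h0[OF \<psi>] unfolding S_def by simp
    finally have "\<psi> (eval ?f v) = \<psi> \<zero>" .
    moreover have "eval ?f v \<in> E"
      using ring_hom_memE(1)[OF eval_is_hom[OF carrier_is_subring]]
        ring.eval_in_carrier[OF subring_is_ring[OF subfieldE(1)[OF E]], of ?f v] \<open>set ?f \<subseteq> K\<close> KE v(1)
        eval_consistent[OF subfieldE(1)[OF E]] by auto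
    ultimately have "eval ?f v = \<zero>"
      using inj_onD[OF subfield_hom_inj[OF E embeddingsD(1)[OF \<psi>]]] subringE(2)[OF subfieldE(1)[OF E]] by blast
    thus "\<phi> w \<in> \<psi> ` S" using v unfolding S_def by blast
  qed
  moreover have "card (\<phi> ` S) = card (\<psi> ` S)"
    using card_image[OF inj[OF \<phi> SE]] card_image[OF inj[OF \<psi> SE]] by simp
  ultimately have "\<phi> ` S = \<psi> ` S" using fS by (simp add: card_subset_eq)
  moreover have "y \<in> S" using y(1) I(4) unfolding S_def by simp
  ultimately have "z \<in> \<phi> ` S" using y(2) by blast
  thus "z \<in> \<phi> ` E" using SE by blast
qed

lemma compose_embedding_Aut:
  assumes E: "subfield E L" and KE: "K \<subseteq> E" and \<psi>: "\<psi> \<in> embeddings K E" and g: "g \<in> Aut_over K E"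
  shows "compose E \<psi> g \<in> embeddings K E" "compose E \<psi> g ` E = \<psi> ` E"
proof -
  have g': "g \<in> embeddings K E" "g ` E = E" using g Aut_over_eq[OF E] by auto
  note gh = embeddingsD[OF g'(1)] and ph = embeddingsD[OF \<psi>]
  have gE: "g x \<in> E" if "x \<in> E" for x using g'(2) that by blast
  note E' = subringE[OF subfieldE(1)[OF E]]
  have "compose E \<psi> g \<in> ring_hom (L\<lparr>carrier := E\<rparr>) L"
    using ring_hom_memE[OF gh(1)] ring_hom_memE[OF ph(1)] gE E'
    by (intro ring_hom_memI) (auto simp: compose_def)
  thus "compose E \<psi> g \<in> embeddings K E"
    using gh(2) ph(2) KE unfolding embeddings_def by (auto simp: compose_def)
  have "compose E \<psi> g ` E = \<psi> ` (g ` E)" by (auto simp: compose_def image_image)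
  thus "compose E \<psi> g ` E = \<psi> ` E" using g'(2) by simp
qed

text \<open>If \<open>\<phi>\<close> and \<open>\<psi>\<close> have the same image, then
  \<open>\<psi>\<close> followed backwards after \<open>\<phi>\<close> is an automorphism. So the
  embeddings with a given image form one orbit of \<open>Aut_over K E\<close> acting by composition
  on the right.\<close>

lemma embeddings_same_image:
  assumes E: "subfield E L" and KE: "K \<subseteq> E" and \<psi>: "\<psi> \<in> embeddings K E"
  shows "{\<phi> \<in> embeddings K E. \<phi> ` E = \<psi> ` E} = compose E \<psi> ` Aut_over K E"
proof (intro equalityI subsetI)
  fix \<phi> assume "\<phi> \<in> {\<phi> \<in> embeddings K E. \<phi> ` E = \<psi> ` E}"
  hence \<phi>: "\<phi> \<in> embeddings K E" "\<phi> ` E = \<psi> ` E" by simp_all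
  note fh = embeddingsD[OF \<phi>(1)] and ph = embeddingsD[OF \<psi>]
  note fm = ring_hom_memE[OF fh(1), simplified] and pm = ring_hom_memE[OF ph(1), simplified]
  note inj = subfield_hom_inj[OF E ph(1)]
  note injf = subfield_hom_inj[OF E fh(1)]
  note E' = subringE[OF subfieldE(1)[OF E]]
  define g where "g = restrict (\<lambda>x. inv_into E \<psi> (\<phi> x)) E"
  have g: "g x \<in> E" "\<psi> (g x) = \<phi> x" if "x \<in> E" for x
  proof -
    have "\<phi> x \<in> \<psi> ` E" using \<phi>(2) that by blast
    thus "g x \<in> E" "\<psi> (g x) = \<phi> x" unfolding g_def using that inv_into_into f_inv_into_f by (metis restrict_apply')+
  qed
  \<comment> \<open>As \<open>g\<close> is given pointwise by \<open>inv_into\<close>, its algebraic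
    identities are verified after applying the injective \<open>\<psi>\<close>.\<close>
  have eqI: "u = v" if "u \<in> E" "v \<in> E" "\<psi> u = \<psi> v" for u v using inj_onD[OF inj that(3,1,2)] .
  have "g \<in> ring_hom (L\<lparr>carrier := E\<rparr>) L"
  proof (rule ring_hom_memI, simp_all)
    fix x assume x: "x \<in> E"
    show "g x \<in> carrier L" using g(1)[OF x] E'(1) by blast
    fix y assume y: "y \<in> E"
    show "g (x \<otimes> y) = g x \<otimes> g y"
      by (rule eqI) (use g x y E' fm pm in auto)
    show "g (x \<oplus> y) = g x \<oplus> g y"
      by (rule eqI) (use g x y E' fm pm in auto)
  next
    show "g \<one> = \<one>" by (rule eqI) (use g E' fm pm in auto)
  qed
  moreover have "g k = k" if "k \<in> K" for k
    by (rule eqI) (use g that KE fh(2) ph(2) in auto)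
  moreover have "g ` E = E"
  proof (intro equalityI subsetI)
    fix y assume y: "y \<in> E"
    then obtain x where x: "x \<in> E" "\<phi> x = \<psi> y" using \<phi>(2) by (metis imageE imageI)
    hence "g x = y" using eqI[of "g x" y] g y by simp
    thus "y \<in> g ` E" using x(1) by blast
  qed (use g in auto)
  moreover have "g \<in> extensional E" unfolding g_def by simp
  ultimately have "g \<in> Aut_over K E" unfolding Aut_over_eq[OF E] embeddings_def by simp
  moreover have "\<phi> = compose E \<psi> g"
    by (rule extensionalityI[OF fh(3) compose_extensional]) (simp add: compose_eq g)
  ultimately show "\<phi> \<in> compose E \<psi> ` Aut_over K E" by blast
next
  fix \<phi> assume "\<phi> \<in> compose E \<psi> ` Aut_over K E"
  thus "\<phi> \<in> {\<phi> \<in> embeddings K E. \<phi> ` E = \<psi> ` E}" using compose_embedding_Aut[OF E KE \<psi>] by blast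
qed

text \<open>The action on the orbit is free, since the injective \<open>\<psi>\<close> can be
  cancelled on the left.\<close>

lemma card_embeddings_same_image:
  assumes E: "subfield E L" and KE: "K \<subseteq> E" and \<psi>: "\<psi> \<in> embeddings K E"
  shows "card {\<phi> \<in> embeddings K E. \<phi> ` E = \<psi> ` E} = card (Aut_over K E)"
proof -
  have "inj_on (compose E \<psi>) (Aut_over K E)"
  proof (rule inj_onI)
    fix g h assume gh: "g \<in> Aut_over K E" "h \<in> Aut_over K E" and eq: "compose E \<psi> g = compose E \<psi> h"
    have g: "g ` E = E" "g \<in> extensional E" and h: "h ` E = E" "h \<in> extensional E"
      using gh embeddingsD(3) unfolding Aut_over_eq[OF E] by auto
    show "g = h"
    proof (rule extensionalityI[OF g(2) h(2)])
      fix x assume x: "x \<in> E"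
      have "\<psi> (g x) = \<psi> (h x)" using fun_cong[OF eq, of x] x by (simp add: compose_eq)
      moreover have "g x \<in> E" "h x \<in> E" using g(1) h(1) x by blast+
      ultimately show "g x = h x" using inj_onD[OF subfield_hom_inj[OF E embeddingsD(1)[OF \<psi>]]] by blast
    qed
  qed
  thus ?thesis unfolding embeddings_same_image[OF assms] by (rule card_image)
qed

lemma id_in_Aut_over:
  assumes "subfield E L" "K \<subseteq> E"
  shows "restrict id E \<in> Aut_over K E"
proof -
  have "id \<in> ring_hom (L\<lparr>carrier := E\<rparr>) L"
    using subfieldE(3)[OF assms(1)] by (auto intro!: ring_hom_memI)
  hence "restrict id E \<in> embeddings K E" using restrict_in_embeddings[OF assms(1), of id K] assms(2) by simp
  thus ?thesis unfolding Aut_over_eq[OF assms(1)] by auto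
qed

text \<open>The polynomial with roots \<open>Aut(E/K) x\<close> has coefficients in the fixed field, so \<open>\<phi>\<close> and
  \<open>\<psi>\<close> map it to the same polynomial, whose roots are the \<open>\<psi>\<close>-images of that orbit.\<close>

lemma image_subset_of_eq_on_fixed_field:
  assumes K: "subfield K L" and E: "subfield E L" and KE: "K \<subseteq> E"
    and fin: "finite (Aut_over K E)"
    and \<phi>: "\<phi> \<in> ring_hom (L\<lparr>carrier := E\<rparr>) L" and \<psi>: "\<psi> \<in> ring_hom (L\<lparr>carrier := E\<rparr>) L"
    and eq: "\<And>x. x \<in> fixed_field E (Aut_over K E) \<Longrightarrow> \<phi> x = \<psi> x"
  shows "\<phi> ` E \<subseteq> \<psi> ` E"
proof (rule image_subsetI)
  fix x assume x: "x \<in> E"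
  let ?A = "Aut_over K E" and ?l = "\<lambda>y. [\<one>, \<ominus> y]"
  define S where "S = (\<lambda>g. g x) ` ?A"
  note E' = subringE[OF subfieldE(1)[OF E]]
  interpret UE: domain "E[X]" using univ_poly_is_domain[OF subfieldE(1)[OF E]] .
  interpret UL: domain "poly_ring L" using univ_poly_is_domain[OF carrier_is_subring] .
  have Ae: "g \<in> ring_hom (L\<lparr>carrier := E\<rparr>) L" "g ` E = E" if "g \<in> ?A" for g
    using that embeddingsD(1) unfolding Aut_over_eq[OF E] by auto
  have gE: "g y \<in> E" if "g \<in> ?A" "y \<in> E" for g y using Ae(2)[OF that(1)] that(2) by blast
  have fS: "finite S" unfolding S_def using fin by simp
  have SE: "S \<subseteq> E" unfolding S_def using gE x by blast
  have xS: "x \<in> S"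
    unfolding S_def using id_in_Aut_over[OF E KE] x by (intro image_eqI[of _ _ "restrict id E"]) simp_all
  \<comment> \<open>The product has one linear factor for each element of the orbit
    \<open>S\<close>.\<close>
  define p where "p = finprod (E[X]) ?l S"
  have lE: "?l \<in> S \<rightarrow> carrier (E[X])"
    using linear_poly_closed[OF subfieldE(1)[OF E]] SE by blast
  have pE: "p \<in> carrier (E[X])" unfolding p_def using UE.finprod_closed[OF lE] .
  have neg: "\<theta> (\<ominus> y) = \<ominus> \<theta> y" if "\<theta> \<in> ring_hom (L\<lparr>carrier := E\<rparr>) L" "y \<in> E" for \<theta> y
  proof -
    interpret t: ring_hom_ring "L\<lparr>carrier := E\<rparr>" L \<theta> using subfield_hom_ring_hom_ring[OF E that(1)] .
    have "\<theta> y \<oplus> \<theta> (\<ominus> y) = \<zero>"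
      using t.hom_add[of y "\<ominus> y"] E'(5)[OF that(2)] that(2) E'(1) t.hom_zero by (simp add: r_neg subset_iff)
    thus ?thesis using t.hom_closed[of y] t.hom_closed[of "\<ominus> y"] E'(5)[OF that(2)] that(2)
      by (simp add: sum_zero_eq_neg add.m_comm)
  qed
  \<comment> \<open>Kept general in \<open>\<theta>\<close>: it is used for the automorphisms, for
    the identity and, through \<open>ev\<close>, for \<open>\<psi>\<close>.\<close>
  have mp: "map \<theta> p = finprod (poly_ring L) (\<lambda>y. ?l (\<theta> y)) S" if t: "\<theta> \<in> ring_hom (L\<lparr>carrier := E\<rparr>) L" for \<theta>
  proof -
    interpret m: ring_hom_cring "E[X]" "poly_ring L" "map \<theta>"
      using ring_hom_cring.intro[OF UE.cring_axioms UL.cring_axioms]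
        map_poly_is_hom[OF E t] unfolding ring_hom_cring_axioms_def by blast
    have "map \<theta> p = finprod (poly_ring L) (map \<theta> \<circ> ?l) S" unfolding p_def using m.hom_finprod[OF lE] .
    also have "\<dots> = finprod (poly_ring L) (\<lambda>y. ?l (\<theta> y)) S"
    proof (rule UL.finprod_cong'[OF refl])
      show "(\<lambda>y. ?l (\<theta> y)) \<in> S \<rightarrow> carrier (poly_ring L)"
        by (intro funcsetI linear_poly_closed[OF carrier_is_subring]) (use ring_hom_memE(1)[OF t] SE in auto)
      show "(map \<theta> \<circ> ?l) y = ?l (\<theta> y)" if "y \<in> S" for y
        using neg[OF t, of y] ring_hom_memE(4)[OF t] that SE by auto
    qed
    finally show ?thesis .
  qed
  have ev: "\<exists>y\<in>S. z = \<theta> y"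
    if t: "\<theta> \<in> ring_hom (L\<lparr>carrier := E\<rparr>) L" and z: "z \<in> carrier L" and e: "eval (map \<theta> p) z = \<zero>" for \<theta> z
  proof -
    have lc: "(\<lambda>y. ?l (\<theta> y)) \<in> S \<rightarrow> carrier (poly_ring L)"
      by (intro funcsetI linear_poly_closed[OF carrier_is_subring]) (use ring_hom_memE(1)[OF t] SE in auto)
    interpret m: ring_hom_cring "poly_ring L" L "\<lambda>p. eval p z"
      using eval_cring_hom[OF carrier_is_subring z] .
    have tc: "\<theta> y \<in> carrier L" if "y \<in> S" for y using ring_hom_memE(1)[OF t] that SE by auto
    have "finprod L ((\<lambda>p. eval p z) \<circ> (\<lambda>y. ?l (\<theta> y))) S = \<zero>"
      using e unfolding mp[OF t] m.hom_finprod[OF lc] .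
    moreover have "((\<lambda>p. eval p z) \<circ> (\<lambda>y. ?l (\<theta> y))) \<in> S \<rightarrow> carrier L"
      using tc z by auto
    ultimately obtain y where y: "y \<in> S" "((\<lambda>p. eval p z) \<circ> (\<lambda>y. ?l (\<theta> y))) y = \<zero>"
      using finprod_eq_zeroD[OF fS] by blast
    hence "z \<ominus> \<theta> y = \<zero>" using z tc[OF y(1)] by (simp add: a_minus_def)
    hence "z = \<theta> y" using r_right_minus_eq[OF z tc[OF y(1)]] by simp
    thus ?thesis using y(1) by blast
  qed
  have eval0: "eval p x = \<zero>"
  proof -
    interpret m: ring_hom_cring "E[X]" L "\<lambda>p. eval p x"
      using eval_cring_hom[OF subfieldE(1)[OF E]] x E'(1) by blast
    have xl: "x \<in> carrier L" using x E'(1) by blast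
    have "p = ?l x \<otimes>\<^bsub>E[X]\<^esub> finprod (E[X]) ?l (S - {x})"
      unfolding p_def using UE.finprod_insert[of "S - {x}" x ?l] fS lE xS
      by (simp add: insert_absorb Pi_def)
    moreover have "?l x \<in> carrier (E[X])" "finprod (E[X]) ?l (S - {x}) \<in> carrier (E[X])"
      using lE xS by (auto intro!: UE.finprod_closed)
    ultimately have "eval p x = eval (?l x) x \<otimes> eval (finprod (E[X]) ?l (S - {x})) x"
      using m.hom_mult by presburger
    moreover have "eval (?l x) x = \<zero>" using xl by (simp add: r_neg)
    ultimately show ?thesis using m.hom_closed[OF \<open>finprod (E[X]) ?l (S - {x}) \<in> carrier (E[X])\<close>] by simp
  qed
  \<comment> \<open>An automorphism maps the finite orbit injectively into itself and so permutes
    the factors. The case of the identity rewrites \<open>p\<close> as a product over the ambient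
    ring, where the two products can be compared.\<close>
  have fixp: "map g p = p" if g: "g \<in> ?A" for g
  proof -
    have idE: "id \<in> ring_hom (L\<lparr>carrier := E\<rparr>) L" using E'(1) by (auto intro!: ring_hom_memI)
    have "g ` S \<subseteq> S"
    proof (rule image_subsetI)
      fix y assume "y \<in> S"
      then obtain h where h: "h \<in> ?A" "y = h x" unfolding S_def by blast
      have ge: "g \<in> embeddings K E" using g unfolding Aut_over_eq[OF E] by simp
      have "compose E g h \<in> ?A"
        using compose_embedding_Aut[OF E KE ge h(1)] Ae(2)[OF g] unfolding Aut_over_eq[OF E] by simp
      moreover have "compose E g h x = g y" using x h(2) by (simp add: compose_eq)
      ultimately show "g y \<in> S" unfolding S_def by (intro image_eqI[of _ _ "compose E g h"]) simp_all
    qed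
    moreover have inj: "inj_on g S" using inj_on_subset[OF subfield_hom_inj[OF E Ae(1)[OF g]] SE] .
    ultimately have gS: "g ` S = S" using fS by (simp add: endo_inj_surj)
    have lL: "?l \<in> g ` S \<rightarrow> carrier (poly_ring L)"
      by (intro funcsetI linear_poly_closed[OF carrier_is_subring]) (use gS SE E'(1) in auto)
    have "map g p = finprod (poly_ring L) (\<lambda>y. ?l (g y)) S" using mp[OF Ae(1)[OF g]] .
    also have "\<dots> = finprod (poly_ring L) ?l (g ` S)" using UL.finprod_reindex[OF lL inj] by simp
    also have "\<dots> = map id p" using mp[OF idE] gS by simp
    finally show ?thesis by simp
  qed
  have "set p \<subseteq> fixed_field E ?A"
  proof
    fix c assume c: "c \<in> set p"
    have "c \<in> E" using c pE polynomial_incl unfolding sym[OF univ_poly_carrier] by blast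
    moreover have "g c = c" if "g \<in> ?A" for g
      using fixp[OF that] c by (metis map_idI map_eq_conv list.map_id id_apply)
    ultimately show "c \<in> fixed_field E ?A" unfolding fixed_field_def by blast
  qed
  \<comment> \<open>The maps agree on the coefficients, so \<open>\<phi> x\<close> is a root of the
    polynomial transported by \<open>\<psi>\<close>, and \<open>ev\<close> identifies it as the
    \<open>\<psi>\<close>-image of an orbit element.\<close>
  hence mm: "map \<phi> p = map \<psi> p" using eq by (auto simp: subset_iff)
  have e: "eval (map \<psi> p) (\<phi> x) = \<zero>"
  proof -
    interpret t: ring_hom_ring "L\<lparr>carrier := E\<rparr>" L \<phi> using subfield_hom_ring_hom_ring[OF E \<phi>] .
    show ?thesis using hom_eval[OF E \<phi> pE x] eval0 t.hom_zero mm by simp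
  qed
  have c: "\<phi> x \<in> carrier L" using ring_hom_memE(1)[OF \<phi>] x by simp
  obtain y where "y \<in> S" "\<phi> x = \<psi> y" using ev[OF \<psi> c e] by blast
  thus "\<phi> x \<in> \<psi> ` E" using SE by blast
qed

end

subsection \<open>Normal extensions\<close>

text \<open>To be applied to embeddings, with restriction to the core as one function and formation
  of the image as the other.\<close>

lemma card_image_eq_of_same_kernel:
  assumes "\<And>x y. x \<in> A \<Longrightarrow> y \<in> A \<Longrightarrow> f x = f y \<longleftrightarrow> g x = g y"
  shows "card (f ` A) = card (g ` A)"
proof -
  define h where "h = (\<lambda>z. g (inv_into A f z))"
  have h: "h (f x) = g x" if "x \<in> A" for x
  proof -
    have "inv_into A f (f x) \<in> A" "f (inv_into A f (f x)) = f x"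
      using that by (auto intro: inv_into_into f_inv_into_f)
    thus ?thesis unfolding h_def using assms that by blast
  qed
  have "inj_on h (f ` A)" using h assms by (auto intro!: inj_onI)
  moreover have "h ` f ` A = g ` A" using h by (auto simp: image_image)
  ultimately show ?thesis using card_image by metis
qed

lemma card_eq_card_image_mult:
  assumes "finite A" "\<And>x. x \<in> A \<Longrightarrow> card {y \<in> A. f y = f x} = n"
  shows "card A = card (f ` A) * n"
proof -
  have "card A = (\<Sum>z\<in>f ` A. card {y \<in> A. f y = z})"
    using sum.image_gen[OF assms(1), of "\<lambda>_. 1::nat" f] by simp
  also have "\<dots> = (\<Sum>z\<in>f ` A. n)" by (rule sum.cong) (use assms(2) in auto)
  finally show ?thesis by simp
qed

context algebraically_closed
begin

lemma mem_of_degree_Irr_one: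
  assumes K: "subfield K L" and x: "x \<in> carrier L" "(algebraic over K) x" and "degree (Irr K x) = 1"
  shows "x \<in> K"
proof -
  note I = IrrE[OF K x]
  obtain a b where ab: "a \<in> K" "b \<in> K" "Irr K x = [a, b]"
    by (rule degree_oneE[OF I(1) assms(4)]) blast
  have a: "a = \<one>" using I(3) ab(3) by simp
  have bL: "b \<in> carrier L" using ab(2) subfieldE(3)[OF K] by blast
  have "x \<oplus> b = \<zero>" using I(4) x(1) bL unfolding ab(3) a by simp
  hence "x = \<ominus> b" using x(1) bL by (simp add: sum_zero_eq_neg)
  thus ?thesis using subringE(5)[OF subfieldE(1)[OF K] ab(2)] by simp
qed

text \<open>Sending \<open>x\<close> to its conjugate \<open>y\<close> defines an embedding of
  \<open>N(x)\<close>, which extends to \<open>E\<close> because the ambient field is algebraically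
  closed.\<close>

lemma exists_embedding_to_conjugate:
  assumes N: "subfield N L" and E: "subfield E L" and NE: "N \<subseteq> E" and fin: "finite_dimension N E"
    and x: "x \<in> E" and y: "is_root (Irr N x) y"
  obtains \<phi> where "\<phi> \<in> embeddings N E" "\<phi> x = y"
proof -
  let ?M = "simple_extension N x"
  have xL: "x \<in> carrier L" using x subfieldE(3)[OF E] by blast
  have alg: "(algebraic over N) x" using finite_dimension_imp_algebraic[OF N subfieldE(1)[OF E] fin x] .
  have M: "subfield ?M L" using simple_extension_is_subfield[OF N xL] alg by simp
  have NM: "N \<subseteq> ?M" using simple_extension_incl[OF subfieldE(3)[OF N] xL] .
  have ME: "?M \<subseteq> E" using simple_extension_subring_incl[OF subfieldE(1)[OF E] NE x] .
  have xM: "x \<in> ?M" using simple_extension_mem[OF subfieldE(1)[OF N] xL] .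
  have "set (Irr N x) \<subseteq> N" using IrrE(1)[OF N xL alg] polynomial_incl unfolding sym[OF univ_poly_carrier] by blast
  hence "map (restrict id N) (Irr N x) = Irr N x" by (intro map_idI) auto
  hence "(restrict id N, y) \<in> (SIGMA \<phi>:embeddings N N. {a. is_root (map \<phi> (Irr N x)) a})"
    using embeddings_self[OF N] y by simp
  hence "(restrict id N, y) \<in> (\<lambda>\<psi>. (restrict \<psi> N, \<psi> x)) ` embeddings N ?M"
    using embeddings_simple_extension_bij[OF N subset_refl xL alg] unfolding bij_betw_def by blast
  then obtain \<psi> where \<psi>: "\<psi> \<in> embeddings N ?M" "\<psi> x = y" by auto
  obtain \<phi> where \<phi>: "\<phi> \<in> embeddings N E" "restrict \<phi> ?M = \<psi>"
    by (rule exists_extension_of_embedding[OF N M E NM ME fin \<psi>(1)])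
  have "\<phi> x = y" using fun_cong[OF \<phi>(2), of x] xM \<psi>(2) by simp
  thus thesis using that[OF \<phi>(1)] by blast
qed

text \<open>The image of \<open>x\<close> is a root of \<open>Irr N x\<close> in the ambient field.
  Its minimal polynomial over \<open>E\<close> divides a polynomial that splits in \<open>E\<close>,
  hence is linear, and the image lies in \<open>E\<close>.\<close>

lemma normal_extension_embedding_image:
  assumes N: "subfield N L" and E: "subfield E L" and NE: "N \<subseteq> E"
    and norm: "normal_extension N E" and \<phi>: "\<phi> \<in> embeddings N E"
  shows "\<phi> ` E \<subseteq> E"
proof (rule image_subsetI)
  fix x assume x: "x \<in> E"
  interpret F: field "L\<lparr>carrier := E\<rparr>" using subfield_iff(2)[OF E] .
  note cons = univ_poly_consistent[OF subfieldE(1)[OF E]]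
  have xL: "x \<in> carrier L" using x subfieldE(3)[OF E] by blast
  have alg: "(algebraic over N) x" using norm x unfolding normal_extension_def by blast
  note I = IrrE[OF N xL alg]
  let ?p = "Irr N x"
  have pE: "?p \<in> carrier (E[X])" using univ_poly_carrier_mono[OF NE I(1)] .
  have pn: "?p \<noteq> []" using Irr_in_poly_ring(2)[OF N xL alg] .
  have sp: "F.splitted ?p" using norm I x unfolding normal_extension_def by blast
  let ?y = "\<phi> x"
  have yL: "?y \<in> carrier L" using ring_hom_memE(1)[OF embeddingsD(1)[OF \<phi>]] x by simp
  have "set ?p \<subseteq> N" using I(1) polynomial_incl unfolding sym[OF univ_poly_carrier] by blast
  hence m: "map \<phi> ?p = ?p" using embeddingsD(2)[OF \<phi>] by (simp add: map_idI subset_iff)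
  have "\<phi> \<zero> = \<zero>" using embeddingsD(2)[OF \<phi>] subringE(2)[OF subfieldE(1)[OF N]] by blast
  hence py: "eval ?p ?y = \<zero>"
    using hom_eval[OF E embeddingsD(1)[OF \<phi>] pE x] I(4) m by simp
  have aE: "(algebraic over E) ?y" using algebraicI[OF pE pn py] .
  note J = IrrE[OF E yL aE]
  let ?q = "Irr E ?y"
  have "?q divides\<^bsub>E[X]\<^esub> ?p"
    using Irr_minimal[OF E yL aE pE py] pdivides_iff_shell[OF E J(1) pE] by simp
  hence "degree ?q = 1"
    using F.splitted_imp_trivial_factors[of ?p ?q] sp pE pn J(1,2)
    unfolding pdivides_def cons by simp
  thus "?y \<in> E" using mem_of_degree_Irr_one[OF E yL aE] by simp
qed

text \<open>Every root of an irreducible polynomial with a root \<open>x\<close> in \<open>E\<close>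
  is the image of \<open>x\<close> under some embedding of \<open>E\<close> over \<open>N\<close>,
  so it lies in \<open>E\<close>. Splitting in the ring \<open>E\<close> follows because all
  irreducible factors over \<open>E\<close> are linear.\<close>

lemma normal_extensionI:
  assumes N: "subfield N L" and E: "subfield E L" and NE: "N \<subseteq> E" and fin: "finite_dimension N E"
    and img: "\<And>\<phi>. \<phi> \<in> embeddings N E \<Longrightarrow> \<phi> ` E \<subseteq> E"
  shows "normal_extension N E"
  unfolding normal_extension_def
proof (intro conjI ballI impI)
  fix x assume "x \<in> E"
  thus "(algebraic over N) x" by (rule finite_dimension_imp_algebraic[OF N subfieldE(1)[OF E] fin])
next
  fix p assume p: "p \<in> carrier (N[X])" and "pirreducible N p \<and> (\<exists>x\<in>E. eval p x = \<zero>)"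
  then obtain x where irr: "pirreducible N p" and x: "x \<in> E" "eval p x = \<zero>" by blast
  interpret F: field "L\<lparr>carrier := E\<rparr>" using subfield_iff(2)[OF E] .
  interpret UN: domain "N[X]" using univ_poly_is_domain[OF subfieldE(1)[OF N]] .
  note cons = univ_poly_consistent[OF subfieldE(1)[OF E]]
  have xL: "x \<in> carrier L" using x subfieldE(3)[OF E] by blast
  have alg: "(algebraic over N) x" using finite_dimension_imp_algebraic[OF N subfieldE(1)[OF E] fin x(1)] .
  note I = IrrE[OF N xL alg]
  have pE: "p \<in> carrier (E[X])" using univ_poly_carrier_mono[OF NE p] .
  \<comment> \<open>\<open>p\<close> may fail to be monic, so it is only associated to
    \<open>Irr N x\<close>; divisibility in the other direction carries the roots of
    \<open>p\<close> over.\<close>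
  have dvd: "Irr N x divides\<^bsub>N[X]\<^esub> p"
    using Irr_minimal[OF N xL alg p x(2)] pdivides_iff_shell[OF N I(1) p] by simp
  have "Irr N x \<notin> Units (N[X])" using pirreducibleE(2)[OF subfieldE(1)[OF N] I(1,2)] .
  hence "Irr N x \<sim>\<^bsub>N[X]\<^esub> p" using divides_pirreducible_condition[OF irr I(1) dvd] by blast
  hence "p divides\<^bsub>N[X]\<^esub> Irr N x" unfolding associated_def by simp
  then obtain r where r: "r \<in> carrier (N[X])" "Irr N x = p \<otimes>\<^bsub>N[X]\<^esub> r" by (auto elim: dividesE)
  have roots_E: "y \<in> E" if y: "y \<in> carrier L" "eval p y = \<zero>" for y
  proof -
    note h = eval_is_hom[OF subfieldE(1)[OF N] y(1)]
    have "eval (Irr N x) y = \<zero>"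
      unfolding r(2) using ring_hom_memE(2)[OF h p r(1)] ring_hom_memE(1)[OF h r(1)] y(2) by simp
    hence "is_root (Irr N x) y" using y(1) Irr_in_poly_ring(2)[OF N xL alg] unfolding is_root_def by simp
    then obtain \<phi> where \<phi>: "\<phi> \<in> embeddings N E" "\<phi> x = y"
      by (rule exists_embedding_to_conjugate[OF N E NE fin x(1)])
    thus "y \<in> E" using img[OF \<phi>(1)] x(1) by blast
  qed
  show "F.splitted p"
  proof (rule F.trivial_factors_imp_splitted)
    show "p \<in> carrier (poly_ring (L\<lparr>carrier := E\<rparr>))" using pE unfolding cons by simp
  next
    \<comment> \<open>A root of \<open>q\<close> in the ambient field is a root of \<open>p\<close>,
      hence lies in \<open>E\<close>, and an irreducible polynomial with a root in its own field is
      linear.\<close>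
    fix q assume q: "q \<in> carrier (poly_ring (L\<lparr>carrier := E\<rparr>))"
      and qi: "pirreducible\<^bsub>L\<lparr>carrier := E\<rparr>\<^esub> (carrier (L\<lparr>carrier := E\<rparr>)) q"
      and qp: "q pdivides\<^bsub>L\<lparr>carrier := E\<rparr>\<^esub> p"
    have qE: "q \<in> carrier (E[X])" "pirreducible E q" "q divides\<^bsub>E[X]\<^esub> p"
      using q qi qp unfolding pdivides_def cons by simp_all
    have qL: "q \<in> carrier (poly_ring L)" using carrier_polynomial_shell[OF subfieldE(1)[OF E] qE(1)] .
    have "degree q \<ge> 1" using pirreducible_degree[OF E qE(1,2)] .
    then obtain y where y: "y \<in> carrier L" "is_root q y" by (rule exists_root_of_degree_pos[OF qL])
    obtain r where r: "r \<in> carrier (E[X])" "p = q \<otimes>\<^bsub>E[X]\<^esub> r" using qE(3) by (auto elim: dividesE)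
    note h = eval_is_hom[OF subfieldE(1)[OF E] y(1)]
    have "eval p y = \<zero>"
      unfolding r(2) using ring_hom_memE(2)[OF h qE(1) r(1)] ring_hom_memE(1)[OF h r(1)] y(2)
      unfolding is_root_def by simp
    hence "y \<in> E" using roots_E y(1) by blast
    hence "F.is_root q y" using y(2) eval_consistent[OF subfieldE(1)[OF E]] unfolding is_root_def F.is_root_def by simp
    hence "F.roots q \<noteq> {#}" using F.roots_mem_iff_is_root[OF q] by auto
    hence "degree q = 1" using F.pirreducible_roots[OF q qi] by blast
    thus "degree q \<le> 1" by simp
  qed
qed

lemma Aut_over_subset_embeddings:
  assumes "subfield E L" "\<phi> \<in> Aut_over K E"
  shows "\<phi> \<in> embeddings K E" "\<phi> ` E = E"
  using assms(2) unfolding Aut_over_eq[OF assms(1)] by auto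

lemma fixed_field_subfield:
  assumes K: "subfield K L" and E: "subfield E L" and KE: "K \<subseteq> E"
  shows "subfield (fixed_field E (Aut_over K E)) L" "K \<subseteq> fixed_field E (Aut_over K E)"
proof -
  let ?F = "fixed_field E (Aut_over K E)"
  note E' = subringE[OF subfieldE(1)[OF E]]
  note D = embeddingsD[OF Aut_over_subset_embeddings(1)[OF E, where K = K]]
  show KF: "K \<subseteq> ?F" unfolding fixed_field_def using KE D(2) by blast
  have F: "x \<in> E" "\<And>g. g \<in> Aut_over K E \<Longrightarrow> g x = x" if "x \<in> ?F" for x
    using that unfolding fixed_field_def by auto
  have FI: "x \<in> ?F" if "x \<in> E" "\<And>g. g \<in> Aut_over K E \<Longrightarrow> g x = x" for x
    using that unfolding fixed_field_def by auto
  show "subfield ?F L"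
  proof (rule subfieldI'[OF subringI])
    show "?F \<subseteq> carrier L" using F(1) E'(1) by blast
    show "\<one> \<in> ?F" using KF subringE(3)[OF subfieldE(1)[OF K]] by blast
  next
    fix x y assume x: "x \<in> ?F" and y: "y \<in> ?F"
    show "x \<otimes> y \<in> ?F"
    proof (rule FI)
      show "x \<otimes> y \<in> E" using F(1)[OF x] F(1)[OF y] E'(6) by blast
      show "g (x \<otimes> y) = x \<otimes> y" if g: "g \<in> Aut_over K E" for g
        using ring_hom_memE(2)[OF D(1)[OF g], of x y] F(1)[OF x] F(1)[OF y] F(2)[OF x g] F(2)[OF y g] by simp
    qed
    show "x \<oplus> y \<in> ?F"
    proof (rule FI)
      show "x \<oplus> y \<in> E" using F(1)[OF x] F(1)[OF y] E'(7) by blast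
      show "g (x \<oplus> y) = x \<oplus> y" if g: "g \<in> Aut_over K E" for g
        using ring_hom_memE(3)[OF D(1)[OF g], of x y] F(1)[OF x] F(1)[OF y] F(2)[OF x g] F(2)[OF y g] by simp
    qed
  next
    fix x assume x: "x \<in> ?F"
    have xL: "x \<in> carrier L" using F(1)[OF x] E'(1) by blast
    show "\<ominus> x \<in> ?F"
    proof (rule FI)
      show nE: "\<ominus> x \<in> E" using E'(5) F(1)[OF x] by blast
      fix g assume g: "g \<in> Aut_over K E"
      interpret g: ring_hom_ring "L\<lparr>carrier := E\<rparr>" L g using subfield_hom_ring_hom_ring[OF E D(1)[OF g]] .
      have "g (\<ominus> x) \<oplus> x = \<zero>"
        using g.hom_add[of "\<ominus> x" x] nE F(1)[OF x] F(2)[OF x g] g.hom_zero xL by (simp add: l_neg)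
      thus "g (\<ominus> x) = \<ominus> x" using g.hom_closed[of "\<ominus> x"] nE xL by (simp add: sum_zero_eq_neg)
    qed
  next
    fix x assume "x \<in> ?F - {\<zero>}"
    hence x: "x \<in> ?F" "x \<noteq> \<zero>" by simp_all
    note i = subfield_m_inv[OF E, of x]
    have xL: "x \<in> carrier L" using F(1)[OF x(1)] E'(1) by blast
    have iE: "inv x \<in> E" "x \<otimes> inv x = \<one>" using i F(1)[OF x(1)] x(2) by auto
    have iL: "inv x \<in> carrier L" using iE(1) E'(1) by blast
    show "inv x \<in> ?F"
    proof (rule FI[OF iE(1)])
      fix g assume g: "g \<in> Aut_over K E"
      have "x \<otimes> g (inv x) = x \<otimes> inv x"
        using ring_hom_memE(2)[OF D(1)[OF g], of x "inv x"] ring_hom_memE(4)[OF D(1)[OF g]]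
          iE F(1)[OF x(1)] F(2)[OF x(1) g] by simp
      thus "g (inv x) = inv x"
        using m_lcancel[OF x(2) xL, of "g (inv x)" "inv x"] iL ring_hom_memE(1)[OF D(1)[OF g], of "inv x"] iE(1) by simp
    qed
  qed
qed

end

subsection \<open>The least field over which the extension is normal\<close>

context algebraically_closed
begin

text \<open>The field \<open>C\<close> of the overview. The description of \<open>N'\<close> as a
  maximal separable subextension is built in, and what has to be proved is that this field is the
  least one over which \<open>E\<close> is normal.\<close>

definition normal_core :: "'a set \<Rightarrow> 'a set \<Rightarrow> 'a set"
  where "normal_core K E = max_separable_subextension K (fixed_field E (Aut_over K E))"

context
  fixes K E :: "'a set"
  assumes K: "subfield K L" and E: "subfield E L" and KE: "K \<subseteq> E" and fin: "finite_dimension K E"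
begin

lemma algebraic_over_base: "x \<in> E \<Longrightarrow> (algebraic over K) x"
  by (rule finite_dimension_imp_algebraic[OF K subfieldE(1)[OF E] fin])

lemma finite_Aut_over: "finite (Aut_over K E)"
  using finite_subset[OF _ embeddings_finite[OF K E KE fin]] Aut_over_subset_embeddings(1)[OF E] by blast

lemma normal_core_eq: "normal_core K E = {x \<in> fixed_field E (Aut_over K E). separable_element K x}"
  unfolding normal_core_def
  by (rule max_separable_subextension_eq[OF K fixed_field_subfield[OF K E KE]])

lemma normal_core_intermediate:
  "subfield (normal_core K E) L" "K \<subseteq> normal_core K E" "normal_core K E \<subseteq> E"
  "normal_core K E \<subseteq> fixed_field E (Aut_over K E)"
  using separable_elements_subfield[OF K fixed_field_subfield[OF K E KE]]
  unfolding normal_core_eq by (auto simp: fixed_field_def)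

text \<open>Agreement spreads from the core to the fixed field by pure inseparability, and the
  inclusion of images is then used in both directions. The maps are plain homomorphisms, so that
  \<open>id\<close>, which is not extensional, can serve as \<open>\<psi>\<close>.\<close>

lemma same_image_of_eq_on_normal_core:
  assumes "\<phi> \<in> ring_hom (L\<lparr>carrier := E\<rparr>) L" "\<psi> \<in> ring_hom (L\<lparr>carrier := E\<rparr>) L"
    and eq: "\<And>x. x \<in> normal_core K E \<Longrightarrow> \<phi> x = \<psi> x"
  shows "\<phi> ` E = \<psi> ` E"
proof -
  let ?F = "fixed_field E (Aut_over K E)"
  have FE: "?F \<subseteq> E" unfolding fixed_field_def by blast
  have F: "\<phi> x = \<psi> x" if x: "x \<in> ?F" for x
    by (rule hom_eq_of_eq_on_separable[OF K E fixed_field_subfield(1)[OF K E KE] FE assms(1,2) eq x])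
      (use x FE algebraic_over_base in \<open>auto simp: normal_core_eq\<close>)
  show ?thesis
    by (rule equalityI[OF image_subset_of_eq_on_fixed_field[OF K E KE finite_Aut_over assms(1,2) F]
          image_subset_of_eq_on_fixed_field[OF K E KE finite_Aut_over assms(2,1) F[symmetric]]])
qed

lemma eq_on_normal_core_iff_same_image:
  assumes \<phi>: "\<phi> \<in> embeddings K E" and \<psi>: "\<psi> \<in> embeddings K E"
  shows "restrict \<phi> (normal_core K E) = restrict \<psi> (normal_core K E) \<longleftrightarrow> \<phi> ` E = \<psi> ` E"
proof
  assume eq: "restrict \<phi> (normal_core K E) = restrict \<psi> (normal_core K E)"
  have "\<phi> x = \<psi> x" if "x \<in> normal_core K E" for x
    using fun_cong[OF eq, of x] that by simp
  thus "\<phi> ` E = \<psi> ` E"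
    using same_image_of_eq_on_normal_core[OF embeddingsD(1)[OF \<phi>] embeddingsD(1)[OF \<psi>]] by blast
next
  assume "\<phi> ` E = \<psi> ` E"
  then obtain g where g: "g \<in> Aut_over K E" "\<phi> = compose E \<psi> g"
    using embeddings_same_image[OF E KE \<psi>] \<phi> by blast
  have "\<phi> x = \<psi> x" if x: "x \<in> normal_core K E" for x
  proof -
    have "x \<in> E" "g x = x" using x normal_core_intermediate(4) g(1) unfolding fixed_field_def by auto
    thus ?thesis unfolding g(2) by (simp add: compose_eq)
  qed
  thus "restrict \<phi> (normal_core K E) = restrict \<psi> (normal_core K E)"
    by (intro restrict_ext) blast
qed

lemma normal_over_normal_core: "normal_extension (normal_core K E) E"
proof (rule normal_extensionI[OF normal_core_intermediate(1) E normal_core_intermediate(3)])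
  show "finite_dimension (normal_core K E) E"
    using finite_dimension_intermediate(2)[OF K normal_core_intermediate(1) E normal_core_intermediate(2,3) fin] .
  fix \<phi> assume \<phi>: "\<phi> \<in> embeddings (normal_core K E) E"
  have "id \<in> ring_hom (L\<lparr>carrier := E\<rparr>) L"
    using subfieldE(3)[OF E] by (auto intro!: ring_hom_memI)
  from same_image_of_eq_on_normal_core[OF embeddingsD(1)[OF \<phi>] this]
  show "\<phi> ` E \<subseteq> E" using embeddingsD(2)[OF \<phi>] by simp
qed

text \<open>Separability is what guarantees a second root: the minimal polynomial of an inseparable
  element may have that element as its only root.\<close>

lemma normal_core_least:
  assumes N: "intermediate_field K N E" and norm: "normal_extension N E"
  shows "normal_core K E \<subseteq> N"
proof (rule subsetI, rule ccontr)
  fix y assume y: "y \<in> normal_core K E" and yN: "y \<notin> N"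
  have N': "subfield N L" "K \<subseteq> N" "N \<subseteq> E" using N unfolding intermediate_field_def by auto
  have finN: "finite_dimension N E" using finite_dimension_intermediate(2)[OF K N'(1) E N'(2,3) fin] .
  have yE: "y \<in> E" using y normal_core_intermediate(3) by blast
  have yL: "y \<in> carrier L" using yE subfieldE(3)[OF E] by blast
  have ys: "separable_element K y" using y unfolding normal_core_eq by simp
  have alg: "(algebraic over N) y"
    using algebraic_mono[OF N'(2)] ys unfolding separable_element_def by blast
  let ?f = "Irr N y"
  have "set ?f \<subseteq> N" using IrrE(1)[OF N'(1) yL alg] polynomial_incl unfolding sym[OF univ_poly_carrier] by blast
  hence m: "map (restrict id N) ?f = ?f" by (intro map_idI) auto
  have "restrict id N \<in> embeddings K N"
    using Aut_over_subset_embeddings(1)[OF N'(1) id_in_Aut_over[OF N'(1,2)]] .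
  from card_map_Irr_roots_separable[OF K N'(1,2) yL ys this]
  have c: "card {a. is_root ?f a} = degree ?f" unfolding m .
  \<comment> \<open>Degree one would place \<open>y\<close> in \<open>N\<close>. As
    \<open>?f\<close> has as many distinct roots as its degree, a root other than \<open>y\<close>
    exists.\<close>
  have "degree ?f \<noteq> 1" using mem_of_degree_Irr_one[OF N'(1) yL alg] yN by blast
  hence "degree ?f \<ge> 2" using Irr_in_poly_ring(3)[OF N'(1) yL alg] by linarith
  moreover have "card {a. is_root ?f a} \<le> 1" if "{a. is_root ?f a} \<subseteq> {y}"
    using card_mono[OF _ that] by simp
  ultimately obtain a where a: "is_root ?f a" "a \<noteq> y" using c by fastforce
  obtain \<tau> where \<tau>: "\<tau> \<in> embeddings N E" "\<tau> y = a"
    by (rule exists_embedding_to_conjugate[OF N'(1) E N'(3) finN yE a(1)])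
  \<comment> \<open>Normality gives only an inclusion; since \<open>E\<close> is algebraic over
    \<open>K\<close>, it improves to equality, which makes \<open>\<tau>\<close> an
    automorphism.\<close>
  have sub: "\<tau> ` E \<subseteq> E" using normal_extension_embedding_image[OF N'(1) E N'(3) norm \<tau>(1)] .
  have \<tau>K: "\<tau> \<in> embeddings K E" using \<tau>(1) N'(2) unfolding embeddings_def by blast
  have idE: "restrict id E \<in> embeddings K E" "restrict id E ` E = E"
    using Aut_over_subset_embeddings[OF E id_in_Aut_over[OF E KE]] by auto
  have "\<tau> ` E = E"
    using embedding_image_eq_of_subset[OF K E KE algebraic_over_base \<tau>K idE(1)] sub unfolding idE(2) by blast
  hence "\<tau> \<in> Aut_over K E" using \<tau>K unfolding Aut_over_eq[OF E] by simp
  hence "\<tau> y = y" using y normal_core_intermediate(4) unfolding fixed_field_def by blast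
  thus False using \<tau>(2) a(2) by simp
qed

lemma intermediate_dim:
  assumes "intermediate_field K N E"
  shows "(dim over K) E = (dim over K) N * (dim over N) E" "(dim over N) E \<ge> 1" "(dim over K) N \<ge> 1"
    "finite_dimension K N"
proof -
  have N: "subfield N L" "K \<subseteq> N" "N \<subseteq> E" using assms unfolding intermediate_field_def by auto
  note d = finite_dimension_intermediate[OF K N(1) E N(2,3) fin]
  show "(dim over K) E = (dim over K) N * (dim over N) E" "(dim over N) E \<ge> 1" "finite_dimension K N"
    using d by blast+
  show "(dim over K) N \<ge> 1"
    using finite_dimension_intermediate(4)[OF K K N(1) subset_refl N(2) d(1)] .
qed

lemma normal_core_intermediate_field: "intermediate_field K (normal_core K E) E"
  using normal_core_intermediate unfolding intermediate_field_def by blast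

text \<open>The core lies in \<open>N\<close>, so the tower formula makes the degree over
  \<open>N\<close> a divisor of the degree over the core, with equality only if the two fields
  coincide. This gives both the maximum and its uniqueness.\<close>

lemma dim_le_dim_normal_core:
  assumes N: "intermediate_field K N E" and norm: "normal_extension N E"
  shows "(dim over N) E \<le> (dim over (normal_core K E)) E"
    "(dim over N) E = (dim over (normal_core K E)) E \<Longrightarrow> N = normal_core K E"
proof -
  have N': "subfield N L" "K \<subseteq> N" "N \<subseteq> E" using N unfolding intermediate_field_def by auto
  note C = normal_core_intermediate
  have CN: "normal_core K E \<subseteq> N" using normal_core_least[OF N norm] .
  have finC: "finite_dimension (normal_core K E) E"
    using finite_dimension_intermediate(2)[OF K C(1) E C(2,3) fin] .
  note d = finite_dimension_intermediate[OF C(1) N'(1) E CN N'(3) finC]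
  have "(dim over (normal_core K E)) N \<ge> 1"
    using finite_dimension_intermediate(4)[OF C(1) C(1) N'(1) subset_refl CN d(1)] .
  thus "(dim over N) E \<le> (dim over (normal_core K E)) E" unfolding d(3) by simp
  assume eq: "(dim over N) E = (dim over (normal_core K E)) E"
  note dN = intermediate_dim[OF N] and dC = intermediate_dim[OF normal_core_intermediate_field]
  have "(dim over K) N = (dim over K) (normal_core K E)"
    using dN(1,2) dC(1) eq by simp
  thus "N = normal_core K E"
    using subfield_eq_of_dim_eq[OF K C(1) N'(1) C(2) CN dN(4)] by simp
qed

section \<open>The index, the conjugate fields and the two counts of embeddings\<close>

lemma descending_normal_index_eq: "descending_normal_index K E = (dim over (normal_core K E)) E"
  unfolding descending_normal_index_def
proof (rule Max_eqI)
  show "finite {(dim over N) E |N. intermediate_field K N E \<and> normal_extension N E}"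
    \<comment> \<open>\<open>Max\<close> is meaningful only for a finite set; the degrees are
      bounded by the degree over the core.\<close>
    by (rule finite_subset[of _ "{..(dim over (normal_core K E)) E}"]) (use dim_le_dim_normal_core(1) in auto)
  show "(dim over (normal_core K E)) E \<in> {(dim over N) E |N. intermediate_field K N E \<and> normal_extension N E}"
    using normal_core_intermediate_field normal_over_normal_core by blast
qed (use dim_le_dim_normal_core(1) in blast)

text \<open>Restriction to the core is onto the embeddings of the core and identifies exactly those
  embeddings of \<open>E\<close> that share an image. The core is separable, so its embeddings are
  as many as its degree.\<close>

lemma card_embedding_images:
  "card ((\<lambda>\<phi>. \<phi> ` E) ` embeddings K E) = (dim over K) (normal_core K E)"
proof -
  note C = normal_core_intermediate
  have "(\<lambda>\<phi>. restrict \<phi> (normal_core K E)) ` embeddings K E = embeddings K (normal_core K E)"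
  proof (intro equalityI subsetI)
    fix \<phi> assume \<phi>: "\<phi> \<in> embeddings K (normal_core K E)"
    obtain \<psi> where "\<psi> \<in> embeddings K E" "restrict \<psi> (normal_core K E) = \<phi>"
      by (rule exists_extension_of_embedding[OF K C(1) E C(2,3) fin \<phi>])
    thus "\<phi> \<in> (\<lambda>\<phi>. restrict \<phi> (normal_core K E)) ` embeddings K E" by blast
  qed (use restrict_embedding[OF E _ C(1-3)] in blast)
  moreover have "card ((\<lambda>\<phi>. restrict \<phi> (normal_core K E)) ` embeddings K E) = card ((\<lambda>\<phi>. \<phi> ` E) ` embeddings K E)"
    by (rule card_image_eq_of_same_kernel[OF eq_on_normal_core_iff_same_image])
  moreover have "card (embeddings K (normal_core K E)) = (dim over K) (normal_core K E)"
    by (rule card_embeddings_separable[OF K C(1,2) intermediate_dim(4)[OF normal_core_intermediate_field]])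
      (simp add: normal_core_eq)
  ultimately show ?thesis by simp
qed

lemma num_conjugate_fields_eq: "num_conjugate_fields K E = (dim over K) (normal_core K E)"
proof -
  have imgs: "{F. intermediate_field K F (carrier L) \<and> isos_over K E F \<noteq> {}} = (\<lambda>\<phi>. \<phi> ` E) ` embeddings K E"
  proof (intro equalityI subsetI)
    fix F assume "F \<in> {F. intermediate_field K F (carrier L) \<and> isos_over K E F \<noteq> {}}"
    then obtain \<phi> where F: "F \<subseteq> carrier L" and iso: "\<phi> \<in> isos_over K E F"
      unfolding intermediate_field_def by blast
    have \<phi>: "\<phi> \<in> ring_hom (L\<lparr>carrier := E\<rparr>) L" "\<And>k. k \<in> K \<Longrightarrow> \<phi> k = k" "\<phi> ` E = F"
      using iso unfolding isos_over_iff[OF E F] by auto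
    have "restrict \<phi> E \<in> embeddings K E" using restrict_in_embeddings[OF E \<phi>(1,2) KE] .
    moreover have "F = restrict \<phi> E ` E" using \<phi>(3) by auto
    ultimately show "F \<in> (\<lambda>\<phi>. \<phi> ` E) ` embeddings K E" by blast
  next
    fix F assume "F \<in> (\<lambda>\<phi>. \<phi> ` E) ` embeddings K E"
    then obtain \<phi> where \<phi>: "\<phi> \<in> embeddings K E" "F = \<phi> ` E" by blast
    have F: "subfield F L" using subfield_hom_image[OF E embeddingsD(1)[OF \<phi>(1)]] \<phi>(2) by simp
    have "K \<subseteq> F"
    proof
      fix k assume k: "k \<in> K"
      hence "\<phi> k = k" "k \<in> E" using embeddingsD(2)[OF \<phi>(1)] KE by auto
      thus "k \<in> F" unfolding \<phi>(2) by force
    qed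
    moreover have "\<phi> \<in> isos_over K E F"
      using embeddingsD[OF \<phi>(1)] \<phi>(2) unfolding isos_over_iff[OF E subfieldE(3)[OF F]] by blast
    ultimately show "F \<in> {F. intermediate_field K F (carrier L) \<and> isos_over K E F \<noteq> {}}"
      using F subfieldE(3)[OF F] unfolding intermediate_field_def by blast
  qed
  show ?thesis unfolding num_conjugate_fields_def imgs by (rule card_embedding_images)
qed

lemma card_embeddings_eq_mult_cluster_size:
  "card (embeddings K E) = (dim over K) (normal_core K E) * cluster_size K E"
proof -
  have "card (embeddings K E) = card ((\<lambda>\<phi>. \<phi> ` E) ` embeddings K E) * card (Aut_over K E)"
    by (rule card_eq_card_image_mult[OF embeddings_finite[OF K E KE fin]])
      (rule card_embeddings_same_image[OF E KE])
  thus ?thesis unfolding card_embedding_images cluster_size_def .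
qed

text \<open>Restriction to the maximal separable subextension is injective by pure inseparability
  and surjective by extension, so \<open>E\<close> has as many embeddings as the degree of that
  subextension.\<close>

lemma card_embeddings_mult_inseparable_degree:
  "card (embeddings K E) * (dim over (max_separable_subextension K E)) E = (dim over K) E"
proof -
  let ?S = "max_separable_subextension K E"
  have S: "?S = {x \<in> E. separable_element K x}" using max_separable_subextension_eq[OF K E KE] .
  have S': "subfield ?S L" "K \<subseteq> ?S" "?S \<subseteq> E"
    using separable_elements_subfield[OF K E KE] unfolding S by auto
  hence i: "intermediate_field K ?S E" unfolding intermediate_field_def by blast
  have "bij_betw (\<lambda>\<phi>. restrict \<phi> ?S) (embeddings K E) (embeddings K ?S)"
    unfolding bij_betw_def
  proof (intro conjI equalityI subsetI)
    show "inj_on (\<lambda>\<phi>. restrict \<phi> ?S) (embeddings K E)"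
    proof (rule inj_onI)
      fix \<phi> \<psi> assume \<phi>: "\<phi> \<in> embeddings K E" and \<psi>: "\<psi> \<in> embeddings K E"
        and eq: "restrict \<phi> ?S = restrict \<psi> ?S"
      have e: "\<phi> x = \<psi> x" if "x \<in> E" "separable_element K x" for x
        using fun_cong[OF eq, of x] that unfolding S by simp
      show "\<phi> = \<psi>"
      proof (rule extensionalityI[OF embeddingsD(3)[OF \<phi>] embeddingsD(3)[OF \<psi>]])
        fix x assume x: "x \<in> E"
        show "\<phi> x = \<psi> x"
          by (rule hom_eq_of_eq_on_separable[OF K E E subset_refl embeddingsD(1)[OF \<phi>] embeddingsD(1)[OF \<psi>] e
                x algebraic_over_base[OF x]])
      qed
    qed
  next
    fix \<phi> assume \<phi>: "\<phi> \<in> embeddings K ?S"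
    obtain \<psi> where "\<psi> \<in> embeddings K E" "restrict \<psi> ?S = \<phi>"
      by (rule exists_extension_of_embedding[OF K S'(1) E S'(2,3) fin \<phi>])
    thus "\<phi> \<in> (\<lambda>\<phi>. restrict \<phi> ?S) ` embeddings K E" by blast
  qed (use restrict_embedding[OF E _ S'(1-3)] in blast)
  hence "card (embeddings K E) = card (embeddings K ?S)" by (rule bij_betw_same_card)
  also have "\<dots> = (dim over K) ?S"
    by (rule card_embeddings_separable[OF K S'(1,2) intermediate_dim(4)[OF i]]) (simp add: S)
  finally show ?thesis using intermediate_dim(1)[OF i] by simp
qed

text \<open>With \<open>C\<close> for the core and \<open>S\<close> for the maximal separable
  subextension, the two counts give \<open>[C:K] r [E:S] = [E:K] = [C:K] [E:C]\<close>, where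
  \<open>r\<close> is the cluster size; the positive factor \<open>[C:K]\<close> cancels.\<close>

lemma dim_normal_core:
  "(dim over (normal_core K E)) E = cluster_size K E * (dim over (max_separable_subextension K E)) E"
proof -
  let ?c = "(dim over K) (normal_core K E)"
  note d = intermediate_dim[OF normal_core_intermediate_field]
  have "?c * (dim over (normal_core K E)) E =
      ?c * (cluster_size K E * (dim over (max_separable_subextension K E)) E)"
    unfolding d(1)[symmetric] mult.assoc[symmetric] card_embeddings_eq_mult_cluster_size[symmetric]
    by (rule card_embeddings_mult_inseparable_degree[symmetric])
  moreover have "?c \<noteq> 0" using d(3) by simp
  ultimately show ?thesis by (simp only: mult_cancel1) blast
qed

lemma normal_iff_dim_normal_core:
  "normal_extension K E \<longleftrightarrow> (dim over (normal_core K E)) E = (dim over K) E"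
proof
  assume "normal_extension K E"
  moreover have "intermediate_field K K E" using K KE unfolding intermediate_field_def by blast
  ultimately have "normal_core K E \<subseteq> K" using normal_core_least by blast
  hence "normal_core K E = K" using normal_core_intermediate(2) by blast
  thus "(dim over (normal_core K E)) E = (dim over K) E" by simp
next
  assume eq: "(dim over (normal_core K E)) E = (dim over K) E"
  note d = intermediate_dim[OF normal_core_intermediate_field]
  have "(dim over K) (normal_core K E) = (dim over K) K"
    using d(1,2) eq dimI[OF K dimension_one[OF K]] by simp
  from subfield_eq_of_dim_eq[OF K K normal_core_intermediate(1) subset_refl normal_core_intermediate(2) d(4) this]
  show "normal_extension K E" using normal_over_normal_core by simp
qed

end

end

theorem proposition2p16:
  fixes \<Omega> :: "('a, 'b) ring_scheme" and K L :: "'a set"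
  assumes "algebraic_closure \<Omega> K"
    and "subfield L \<Omega>" and "K \<subseteq> L" and "ring.finite_dimension \<Omega> K L"
  shows
    "(\<exists>!N'. ring.intermediate_field \<Omega> K N' L \<and> ring.normal_extension \<Omega> N' L \<and>
            (ring.dim \<Omega> over N') L = ring.descending_normal_index \<Omega> K L) \<and>
     (\<forall>N'. ring.intermediate_field \<Omega> K N' L \<and> ring.normal_extension \<Omega> N' L \<and>
            (ring.dim \<Omega> over N') L = ring.descending_normal_index \<Omega> K L \<longrightarrow>
        (\<forall>N''. ring.intermediate_field \<Omega> K N'' L \<and> ring.normal_extension \<Omega> N'' L \<longrightarrow> N' \<subseteq> N'') \<and>
        N' = ring.max_separable_subextension \<Omega> K
               (fixed_field L (ring.Aut_over \<Omega> K L))) \<and>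
     ring.descending_normal_index \<Omega> K L =
       ring.cluster_size \<Omega> K L * (ring.dim \<Omega> over (ring.max_separable_subextension \<Omega> K L)) L \<and>
     ring.descending_normal_index \<Omega> K L = ring.multicluster_size \<Omega> K L \<and>
     ring.descending_normal_index \<Omega> K L * ring.num_conjugate_fields \<Omega> K L =
       (ring.dim \<Omega> over K) L \<and>
     (ring.normal_extension \<Omega> K L \<longleftrightarrow>
       ring.descending_normal_index \<Omega> K L = (ring.dim \<Omega> over K) L)"
proof -
  interpret algebraic_closure \<Omega> K using assms(1) .
  \<comment> \<open>These are the four assumptions of the context on the normal core, with
    \<open>L\<close> in the place of \<open>E\<close> and \<open>\<Omega>\<close> as the ambient
    field.\<close>
  note ctx = subfield_axioms assms(2-4)
  let ?C = "normal_core K L"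
  have core: "intermediate_field K ?C L" "normal_extension ?C L" "(dim over ?C) L = descending_normal_index K L"
    using normal_core_intermediate_field[OF ctx] normal_over_normal_core[OF ctx]
      descending_normal_index_eq[OF ctx] by simp_all
  have unique: "N = ?C"
    if "intermediate_field K N L" "normal_extension N L" "(dim over N) L = descending_normal_index K L" for N
    using dim_le_dim_normal_core(2)[OF ctx that(1,2)] that(3) descending_normal_index_eq[OF ctx] by simp
  have "\<exists>!N'. intermediate_field K N' L \<and> normal_extension N' L \<and> (dim over N') L = descending_normal_index K L"
    using core unique by blast
  moreover have "\<forall>N'. intermediate_field K N' L \<and> normal_extension N' L \<and>
      (dim over N') L = descending_normal_index K L \<longrightarrow>
      (\<forall>N''. intermediate_field K N'' L \<and> normal_extension N'' L \<longrightarrow> N' \<subseteq> N'') \<and>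
      N' = max_separable_subextension K (fixed_field L (Aut_over K L))"
    using unique normal_core_least[OF ctx] normal_core_def by blast
  moreover have "descending_normal_index K L = cluster_size K L * (dim over (max_separable_subextension K L)) L"
    using dim_normal_core[OF ctx] descending_normal_index_eq[OF ctx] by simp
  moreover from this have "descending_normal_index K L = multicluster_size K L"
    unfolding multicluster_size_def by (simp add: mult.commute)
  moreover have "descending_normal_index K L * num_conjugate_fields K L = (dim over K) L"
    using intermediate_dim(1)[OF ctx core(1)] descending_normal_index_eq[OF ctx] num_conjugate_fields_eq[OF ctx]
    by (simp add: mult.commute)
  moreover have "normal_extension K L \<longleftrightarrow> descending_normal_index K L = (dim over K) L"
    using normal_iff_dim_normal_core[OF ctx] descending_normal_index_eq[OF ctx] by simp
  ultimately show ?thesis by blast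
qed

end
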